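(* Let $k$ be an uncountable field and let $D$ be a division algebra over $k$. Let $a \in D$ be nonzero and let $E := C(a;D) = \{d \in D \mid da = ad\}$ be the centralizer of $a$ in $D$. If $\operatorname{char} k = p > 0$, assume further that there is no $u \in D$ such that $aua^{-1} = u+1$. If $D$ is neither left algebraic nor right algebraic over $E$, then $D$ contains a free $k$-algebra on two generators.
   Context: A division algebra over $k$ is a division ring $D$ which is a $k$-algebra, i.e. $k$ is contained in the center of $D$. If $D$ is a division ring and $E$ is a division subring (not necessarily central), an element $b \in D$ is left algebraic over $E$ if the sum $\sum_{i\ge 0} E b^i$ is not direct, i.e. there are $m \ge 0$ and $c_0,\dots,c_m \in E$, not all zero, with $\sum_{i=0}^m c_i b^i = 0$; $b$ is right algebraic over $E$ if the sum $\sum_{i\ge 0} b^i E$ is not direct, i.e. there are $c_0,\dots,c_m\in E$, not all zero, with $\sum_{i=0}^m b^i c_i = 0$. $D$ is left (resp. right) algebraic over $E$ if every element of $D$ is left (resp. right) algebraic over $E$. "$D$ contains a free $k$-algebra on two generators" means there are $x,y\in D$ such that the $k$-subalgebra $k\langle x,y\rangle\subseteq D$ is free (noncommutative) on $x,y$. *)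

theory Defs
  imports
    "HOL-Computational_Algebra.Computational_Algebra"
    "HOL-Library.Countable_Set"
    "HOL-Library.Poly_Mapping"
begin

section \<open>Algebras over a field\<close>

text \<open>
  Unital associative algebras over a field, not necessarily commutative. The structure map
  \<open>c \<mapsto> scale c 1\<close> sends \<open>k\<close> into the centre (and is injective as soon as \<open>1 \<noteq> 0\<close>), so a
  division algebra over \<open>k\<close> is a type of class \<^class>\<open>division_ring\<close> with such a \<open>scale\<close>.
\<close>

locale k_algebra = vector_space scale
  for scale :: "'k::field \<Rightarrow> 'a::ring_1 \<Rightarrow> 'a" +
  assumes scale_mult_left: "scale c x * y = scale c (x * y)"
    and scale_mult_right: "x * scale c y = scale c (x * y)"

definition subalgebra :: "('k \<Rightarrow> 'a \<Rightarrow> 'a) \<Rightarrow> 'a::ring_1 set \<Rightarrow> bool" where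
  "subalgebra scale S \<longleftrightarrow>
     1 \<in> S \<and> (\<forall>x\<in>S. \<forall>y\<in>S. x + y \<in> S \<and> x * y \<in> S) \<and> (\<forall>c. \<forall>x\<in>S. scale c x \<in> S)"

definition algebra_hom ::
  "('k \<Rightarrow> 'a \<Rightarrow> 'a) \<Rightarrow> ('k \<Rightarrow> 'b \<Rightarrow> 'b) \<Rightarrow> ('a::ring_1 \<Rightarrow> 'b::ring_1) \<Rightarrow> bool" where
  "algebra_hom scaleA scaleB \<phi> \<longleftrightarrow>
     \<phi> 1 = 1 \<and> (\<forall>x y. \<phi> (x + y) = \<phi> x + \<phi> y) \<and> (\<forall>x y. \<phi> (x * y) = \<phi> x * \<phi> y) \<and>
     (\<forall>c x. \<phi> (scaleA c x) = scaleB c (\<phi> x))"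


section \<open>Free algebras\<close>

text \<open>
  The free monoid on \<open>'x\<close>, written additively because \<^theory>\<open>HOL-Library.Poly_Mapping\<close>
  multiplies finitely supported functions by convolution over a \<^class>\<open>monoid_add\<close>. With this
  instance, \<open>'x free_monoid \<Rightarrow>\<^sub>0 'k\<close> is the monoid ring of the free monoid, that is, the free
  (noncommutative) \<open>k\<close>-algebra on \<open>'x\<close>.
\<close>

datatype 'x free_monoid = Monomial (letters: "'x list")

instantiation free_monoid :: (type) monoid_add
begin

definition zero_free_monoid :: "'a free_monoid" where
  "0 = Monomial []"

definition plus_free_monoid :: "'a free_monoid \<Rightarrow> 'a free_monoid \<Rightarrow> 'a free_monoid" where
  "u + v = Monomial (letters u @ letters v)"

instance
  by standard (simp_all add: zero_free_monoid_def plus_free_monoid_def)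

end

definition free_gen :: "'x \<Rightarrow> 'x free_monoid \<Rightarrow>\<^sub>0 'k::field" where
  "free_gen i = Poly_Mapping.single (Monomial [i]) 1"

definition free_scale ::
  "'k::field \<Rightarrow> ('x free_monoid \<Rightarrow>\<^sub>0 'k) \<Rightarrow> ('x free_monoid \<Rightarrow>\<^sub>0 'k)" where
  "free_scale c f = Poly_Mapping.map (\<lambda>z. c * z) f"

lemma lookup_free_scale [simp]:
  "Poly_Mapping.lookup (free_scale c f) w = c * Poly_Mapping.lookup f w"
  by (simp add: free_scale_def Poly_Mapping.map.rep_eq when_def)

lemma poly_mapping_add_single_induct [case_names zero add_single]:
  assumes "P 0" and "\<And>f w c. P f \<Longrightarrow> P (f + Poly_Mapping.single w c)"
  shows "P f"
proof (induction f rule: Poly_Mapping.update_induct)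
  case const
  show ?case by (fact assms(1))
next
  case (update f w c)
  then have "Poly_Mapping.update w c f = f + Poly_Mapping.single w c"
    by (intro poly_mapping_eqI) (auto simp: lookup_update lookup_add lookup_single in_keys_iff)
  with update assms(2) show ?case by simp
qed

lemma free_scale_eq_single_mult: "free_scale c f = Poly_Mapping.single 0 c * f"
proof (induction f rule: poly_mapping_add_single_induct)
  case zero
  show ?case by (intro poly_mapping_eqI) simp
next
  case (add_single f w d)
  have "free_scale c (f + Poly_Mapping.single w d)
      = free_scale c f + Poly_Mapping.single w (c * d)"
    by (intro poly_mapping_eqI) (simp add: lookup_add lookup_single when_def algebra_simps)
  with add_single show ?case
    by (simp add: distrib_left mult_single)
qed

lemma k_algebra_free_scale: "k_algebra (free_scale :: 'k::field \<Rightarrow> ('x free_monoid \<Rightarrow>\<^sub>0 'k) \<Rightarrow> _)"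
proof
  fix a b :: 'k and x y :: "'x free_monoid \<Rightarrow>\<^sub>0 'k"
  show "free_scale a (x + y) = free_scale a x + free_scale a y"
    and "free_scale (a + b) x = free_scale a x + free_scale b x"
    and "free_scale a (free_scale b x) = free_scale (a * b) x"
    and "free_scale 1 x = x"
    by (intro poly_mapping_eqI; simp add: lookup_add algebra_simps)+
  show "free_scale a x * y = free_scale a (x * y)"
    by (simp add: free_scale_eq_single_mult mult.assoc)
  have comm: "f * Poly_Mapping.single 0 a = Poly_Mapping.single 0 a * f"
    for f :: "'x free_monoid \<Rightarrow>\<^sub>0 'k"
    by (induction f rule: poly_mapping_add_single_induct)
      (simp_all add: mult_single mult.commute distrib_left distrib_right)
  show "x * free_scale a y = free_scale a (x * y)"
    by (metis comm free_scale_eq_single_mult mult.assoc)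
qed

text \<open>
  The subalgebra generated by the family \<open>v\<close> is free on \<open>v\<close>: it is the isomorphic image of the
  free algebra under a homomorphism that sends the generators to the members of \<open>v\<close>.
\<close>

definition free_on :: "('k::field \<Rightarrow> 'a \<Rightarrow> 'a) \<Rightarrow> ('x \<Rightarrow> 'a::ring_1) \<Rightarrow> bool" where
  "free_on scale v \<longleftrightarrow>
     (\<exists>\<phi> :: ('x free_monoid \<Rightarrow>\<^sub>0 'k) \<Rightarrow> 'a.
        algebra_hom free_scale scale \<phi> \<and> (\<forall>i. \<phi> (free_gen i) = v i) \<and>
        bij_betw \<phi> UNIV (subalgebra scale hull range v))"

definition contains_free_algebra_2 :: "('k::field \<Rightarrow> 'a \<Rightarrow> 'a::ring_1) \<Rightarrow> bool" where
  "contains_free_algebra_2 scale \<longleftrightarrow>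
     (\<exists>x y. free_on scale (\<lambda>b::bool. if b then x else y))"


section \<open>Centralizers and one-sided algebraicity\<close>

definition centralizer :: "'a::ring_1 \<Rightarrow> 'a set" where
  "centralizer a = {d. d * a = a * d}"

definition left_algebraic_elt :: "'a::ring_1 set \<Rightarrow> 'a \<Rightarrow> bool" where
  "left_algebraic_elt E b \<longleftrightarrow>
     (\<exists>(m::nat) c. (\<forall>i\<le>m. c i \<in> E) \<and> (\<exists>i\<le>m. c i \<noteq> 0) \<and> (\<Sum>i\<le>m. c i * b ^ i) = 0)"

definition right_algebraic_elt :: "'a::ring_1 set \<Rightarrow> 'a \<Rightarrow> bool" where
  "right_algebraic_elt E b \<longleftrightarrow>
     (\<exists>(m::nat) c. (\<forall>i\<le>m. c i \<in> E) \<and> (\<exists>i\<le>m. c i \<noteq> 0) \<and> (\<Sum>i\<le>m. b ^ i * c i) = 0)"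

definition left_algebraic_over :: "'a::ring_1 set \<Rightarrow> bool" where
  "left_algebraic_over E \<longleftrightarrow> (\<forall>b. left_algebraic_elt E b)"

definition right_algebraic_over :: "'a::ring_1 set \<Rightarrow> bool" where
  "right_algebraic_over E \<longleftrightarrow> (\<forall>b. right_algebraic_elt E b)"

end

theory Submission
  imports Defs "HOL-Library.Function_Algebras"
begin

text \<open>
  Write \<open>E\<close> for the centralizer of \<open>a\<close> and \<open>[a, u] = a u - u a\<close>. The free generators are
  \<open>X = (\<mu> - b^2)^{-1} (\<lambda> - a)^{-1}\<close> and \<open>Y = b (\<mu> - b^2)^{-1} (\<lambda> - a)^{-1}\<close>,
  where \<open>b\<close> is neither left nor right algebraic over \<open>E\<close> and \<open>\<lambda>, \<mu> \<in> k\<close> are generic. Four ideas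
  show that this works.

  A single \<open>b\<close> suffices. The hypotheses only provide some \<open>b\<^sub>0\<close> that is not left algebraic and
  some \<open>b\<^sub>1\<close> that is not right algebraic. On the line \<open>b\<^sub>0 + x (b\<^sub>1 - b\<^sub>0)\<close>, \<open>x \<in> k\<close>, left
  algebraicity of bounded degree at infinitely many \<open>x\<close> specializes to \<open>x = 0\<close>, and right
  algebraicity to \<open>x = 1\<close>. So for every degree the bad \<open>x\<close> are finite in number, and \<open>k\<close> is
  uncountable (\<open>exists_neither_left_nor_right_algebraic\<close>).

  Words are independent unless a commutator intervenes. Let \<open>y = (\<lambda> - a)^{-1}\<close>, and let
  \<open>W = y b\<^sub>i y b\<^sub>j y \<dots>\<close> be a word. Multiplication by \<open>\<lambda> - a\<close> strips the first \<open>y\<close> from \<open>d W\<close> and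
  leaves the error \<open>- [a, d] W\<close>. Consider a shortest linear relation between such words
  modulo polynomials in \<open>\<lambda>\<close>, with coefficients \<open>d\<close> that do not involve \<open>\<lambda>\<close> and with one leading
  coefficient equal to \<open>1\<close>. This operation produces a shorter relation, whose coefficients must vanish. That says
  \<open>[a, u] = \<Sum> e\<^sub>i b\<^sub>i\<close> with all \<open>e\<^sub>i\<close> commuting with \<open>a\<close> and one of them equal to \<open>1\<close>
  (\<open>iterated_words_independent\<close>). This is the noncommutative form of the linear independence of
  iterated integrals.

  Resolvents are not commutators. Let \<open>s\<close> be a central variable and \<open>z = (s - b^2)^{-1}\<close>. If
  \<open>[a, u] = f\<^sub>1 z + f\<^sub>2 b z\<close> with \<open>u, f\<^sub>1, f\<^sub>2 \<in> D(s)\<close> and \<open>f\<^sub>1, f\<^sub>2\<close> commuting with \<open>a\<close>, then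
  \<open>f\<^sub>1 = f\<^sub>2 = 0\<close>. Indeed, consider the left and the right denominators of \<open>u\<close>, which are one-sided
  ideals of \<open>D[s]\<close>. The right-hand side has its only pole along \<open>s - b^2\<close>, and this forces one of the two
  ideals to be stable under multiplication by \<open>a\<close> on both sides. An ideal of that kind contains a
  monic polynomial with coefficients in \<open>E\<close>. For right denominators this polynomial makes \<open>b\<close> right
  algebraic over \<open>E\<close>, for left denominators it makes \<open>b\<close> left algebraic
  (\<open>resolvent_terms_vanish_if_commutator\<close>). The use of \<open>b^2\<close> instead of \<open>b\<close> leaves room for the
  second generator: even and odd powers of \<open>b\<close> do not interact.

  Only countably many relations matter. If the evaluation homomorphism of the free algebra kills
  no nonzero element with coefficients in the prime ring, it is injective
  (\<open>inj_free_eval_if_integral_kernel_trivial\<close>). By the two preceding ideas each such element is killed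
  for few \<open>(\<mu>, \<lambda>)\<close> only, so an uncountable field contains parameters that avoid all of them.

  The division ring \<open>D(s)\<close> is represented by functions \<open>k \<Rightarrow> D\<close> of the form \<open>p q^{-1}\<close> with
  polynomial functions \<open>p\<close> and \<open>q \<noteq> 0\<close>, taken modulo equality at all but finitely many points.
  Specialization of \<open>s\<close> to an element of \<open>k\<close> is then evaluation.
\<close>

section \<open>Polynomial functions in a central variable\<close>

locale infinite_division_algebra = k_algebra scale
  for scale :: "'k::field \<Rightarrow> 'd::division_ring \<Rightarrow> 'd" +
  assumes infinite_field: "infinite (UNIV :: 'k set)"
begin

text \<open>
  The polynomials in one central variable with coefficients in \<open>D\<close>, represented by the functions
  that they induce on \<open>k\<close>. The bound \<open>n\<close> on the degree is strict, so that \<open>poly_below 0\<close> consists of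
  the zero polynomial.
\<close>

definition poly_below :: "nat \<Rightarrow> ('k \<Rightarrow> 'd) set" where
  "poly_below n = {f. \<exists>c. f = (\<lambda>x. \<Sum>i<n. scale (x ^ i) (c i))}"

definition polys :: "('k \<Rightarrow> 'd) set" where
  "polys = (\<Union>n. poly_below n)"

lemma poly_belowI: "(\<lambda>x. \<Sum>i<n. scale (x ^ i) (c i)) \<in> poly_below n"
  by (auto simp: poly_below_def)

lemma poly_below_0 [simp]: "poly_below 0 = {0}"
  by (auto simp: poly_below_def fun_eq_iff)

lemma poly_below_Suc_iff_top:
  "f \<in> poly_below (Suc n) \<longleftrightarrow> (\<exists>g\<in>poly_below n. \<exists>c. f = (\<lambda>x. g x + scale (x ^ n) c))"
proof
  assume "f \<in> poly_below (Suc n)"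
  then obtain c where "f = (\<lambda>x. \<Sum>i<Suc n. scale (x ^ i) (c i))"
    unfolding poly_below_def by blast
  then show "\<exists>g\<in>poly_below n. \<exists>c. f = (\<lambda>x. g x + scale (x ^ n) c)"
    by (intro bexI[OF _ poly_belowI[where c = c]] exI[of _ "c n"]) simp
next
  assume "\<exists>g\<in>poly_below n. \<exists>c. f = (\<lambda>x. g x + scale (x ^ n) c)"
  then obtain c d where f: "f = (\<lambda>x. (\<Sum>i<n. scale (x ^ i) (c i)) + scale (x ^ n) d)"
    unfolding poly_below_def by blast
  have "f = (\<lambda>x. \<Sum>i<Suc n. scale (x ^ i) ((c(n := d)) i))"
    unfolding f by (intro ext) simp
  then show "f \<in> poly_below (Suc n)"
    unfolding poly_below_def by blast
qed

lemma poly_below_Suc_iff_bottom: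
  "f \<in> poly_below (Suc n) \<longleftrightarrow> (\<exists>g\<in>poly_below n. \<exists>c. f = (\<lambda>x. c + scale x (g x)))"
proof
  assume "f \<in> poly_below (Suc n)"
  then obtain c where "f = (\<lambda>x. \<Sum>i<Suc n. scale (x ^ i) (c i))"
    unfolding poly_below_def by blast
  then show "\<exists>g\<in>poly_below n. \<exists>c. f = (\<lambda>x. c + scale x (g x))"
    by (intro bexI[OF _ poly_belowI[where c = "c \<circ> Suc"]] exI[of _ "c 0"])
       (simp add: sum.lessThan_Suc_shift scale_sum_right del: sum.lessThan_Suc)
next
  assume "\<exists>g\<in>poly_below n. \<exists>c. f = (\<lambda>x. c + scale x (g x))"
  then obtain c d where f: "f = (\<lambda>x. d + scale x (\<Sum>i<n. scale (x ^ i) (c i)))"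
    unfolding poly_below_def by blast
  have "f = (\<lambda>x. \<Sum>i<Suc n. scale (x ^ i) (case_nat d c i))"
    unfolding f by (simp add: sum.lessThan_Suc_shift scale_sum_right del: sum.lessThan_Suc)
  then show "f \<in> poly_below (Suc n)"
    unfolding poly_below_def by blast
qed

lemma poly_below_Suc_mono: "f \<in> poly_below n \<Longrightarrow> f \<in> poly_below (Suc n)"
  unfolding poly_below_Suc_iff_top by (rule bexI[of _ f]) (auto intro!: exI[of _ 0])

lemma poly_below_mono: "n \<le> m \<Longrightarrow> f \<in> poly_below n \<Longrightarrow> f \<in> poly_below m"
  by (induction rule: dec_induct) (auto intro: poly_below_Suc_mono)

lemma zero_in_poly_below [simp]: "0 \<in> poly_below n"
  by (rule poly_below_mono[of 0]) auto

lemma poly_below_add: "f \<in> poly_below n \<Longrightarrow> g \<in> poly_below n \<Longrightarrow> f + g \<in> poly_below n"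
proof -
  assume "f \<in> poly_below n" "g \<in> poly_below n"
  then obtain c d where fg: "f = (\<lambda>x. \<Sum>i<n. scale (x ^ i) (c i))" "g = (\<lambda>x. \<Sum>i<n. scale (x ^ i) (d i))"
    unfolding poly_below_def by blast
  have "f + g = (\<lambda>x. \<Sum>i<n. scale (x ^ i) (c i + d i))"
    unfolding fg by (intro ext) (simp add: scale_right_distrib sum.distrib)
  then show ?thesis
    by (simp only: poly_belowI)
qed

lemma poly_below_const_mult_left: "f \<in> poly_below n \<Longrightarrow> (\<lambda>_. d) * f \<in> poly_below n"
proof -
  assume "f \<in> poly_below n"
  then obtain c where f: "f = (\<lambda>x. \<Sum>i<n. scale (x ^ i) (c i))"
    unfolding poly_below_def by blast
  have "(\<lambda>_. d) * f = (\<lambda>x. \<Sum>i<n. scale (x ^ i) (d * c i))"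
    unfolding f by (intro ext) (simp add: scale_mult_right sum_distrib_left)
  then show ?thesis
    by (simp only: poly_belowI)
qed

lemma poly_below_const_mult_right: "f \<in> poly_below n \<Longrightarrow> f * (\<lambda>_. d) \<in> poly_below n"
proof -
  assume "f \<in> poly_below n"
  then obtain c where f: "f = (\<lambda>x. \<Sum>i<n. scale (x ^ i) (c i))"
    unfolding poly_below_def by blast
  have "f * (\<lambda>_. d) = (\<lambda>x. \<Sum>i<n. scale (x ^ i) (c i * d))"
    unfolding f by (intro ext) (simp add: scale_mult_left sum_distrib_right)
  then show ?thesis
    by (simp only: poly_belowI)
qed

lemma poly_below_diff: "f \<in> poly_below n \<Longrightarrow> g \<in> poly_below n \<Longrightarrow> f - g \<in> poly_below n"
proof -
  assume "f \<in> poly_below n" "g \<in> poly_below n"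
  then have "f + (\<lambda>_. - 1) * g \<in> poly_below n"
    by (intro poly_below_add poly_below_const_mult_left)
  also have "f + (\<lambda>_. - 1) * g = f - g"
    by (rule ext) simp
  finally show ?thesis .
qed

lemma const_in_poly_below: "(\<lambda>_. d) \<in> poly_below (Suc n)"
  unfolding poly_below_Suc_iff_bottom by (rule bexI[of _ 0]) auto

lemma poly_below_scale: "f \<in> poly_below n \<Longrightarrow> (\<lambda>x. scale x (f x)) \<in> poly_below (Suc n)"
  unfolding poly_below_Suc_iff_bottom by (rule bexI[of _ f]) (auto intro!: exI[of _ 0])

lemma poly_below_mult: "f \<in> poly_below n \<Longrightarrow> g \<in> poly_below m \<Longrightarrow> f * g \<in> poly_below (n + m)"
proof (induction n arbitrary: f)
  case (Suc n)
  then obtain h c where h: "h \<in> poly_below n" "f = (\<lambda>x. c + scale x (h x))"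
    unfolding poly_below_Suc_iff_bottom by blast
  have "f * g = (\<lambda>_. c) * g + (\<lambda>x. scale x ((h * g) x))"
    by (simp add: h fun_eq_iff distrib_right scale_mult_left)
  moreover have "(\<lambda>_. c) * g \<in> poly_below (Suc n + m)"
    by (rule poly_below_mono[OF _ poly_below_const_mult_left[OF Suc.prems(2)]]) simp
  moreover have "(\<lambda>x. scale x ((h * g) x)) \<in> poly_below (Suc n + m)"
    using poly_below_scale[OF Suc.IH[OF h(1) Suc.prems(2)]] by simp
  ultimately show ?case
    by (simp only: poly_below_add)
qed simp

lemma polysE:
  assumes "f \<in> polys"
  obtains n c where "f = (\<lambda>x. \<Sum>i<n. scale (x ^ i) (c i))"
  using assms unfolding polys_def poly_below_def by blast

lemma polys_add [intro]:
  assumes "f \<in> polys" "g \<in> polys"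
  shows "f + g \<in> polys"
proof -
  obtain n m where "f \<in> poly_below n" "g \<in> poly_below m"
    using assms unfolding polys_def by blast
  then have "f + g \<in> poly_below (max n m)"
    by (intro poly_below_add) (auto elim!: poly_below_mono[rotated])
  then show ?thesis
    unfolding polys_def by blast
qed

lemma polys_diff [intro]:
  assumes "f \<in> polys" "g \<in> polys"
  shows "f - g \<in> polys"
proof -
  obtain n m where "f \<in> poly_below n" "g \<in> poly_below m"
    using assms unfolding polys_def by blast
  then have "f - g \<in> poly_below (max n m)"
    by (intro poly_below_diff) (auto elim!: poly_below_mono[rotated])
  then show ?thesis
    unfolding polys_def by blast
qed

lemma polys_mult [intro]: "f \<in> polys \<Longrightarrow> g \<in> polys \<Longrightarrow> f * g \<in> polys"
  unfolding polys_def by (blast intro: poly_below_mult)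

lemma polys_const [intro, simp]: "(\<lambda>_. d) \<in> polys"
  unfolding polys_def using const_in_poly_below by blast

lemma polys_zero [intro, simp]: "0 \<in> polys"
  unfolding polys_def by auto

lemma polys_one [intro, simp]: "1 \<in> polys"
  unfolding one_fun_def by (rule polys_const)

lemma polys_scalar [intro, simp]: "(\<lambda>x. scale x 1) \<in> polys"
  unfolding polys_def using poly_below_scale[OF const_in_poly_below[of 1 0]] by blast

text \<open>
  A \<open>k\<close>-linear functional on \<open>D\<close> that sends \<open>c j\<close> to \<open>1\<close> turns the given function into an ordinary
  polynomial over the field \<open>k\<close>, which has only finitely many roots unless it is zero. So a
  polynomial function determines its coefficients.
\<close>

lemma poly_coeff_eq_0:
  assumes inf: "infinite {x. (\<Sum>i<n. scale (x ^ i) (c i)) = 0}" and "j < n"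
  shows "c j = 0"
proof (rule ccontr)
  assume nz: "c j \<noteq> 0"
  define B where "B = extend_basis {c j}"
  have indep: "independent {c j}"
    using nz by simp
  have B: "independent B" "span B = UNIV" "c j \<in> B"
    using independent_extend_basis[OF indep] span_extend_basis[OF indep]
      extend_basis_superset[OF indep] by (auto simp: B_def)
  define \<phi> where "\<phi> v = representation B v (c j)" for v
  define p where "p = (\<Sum>i<n. monom (\<phi> (c i)) i)"
  have "\<phi> (\<Sum>i<n. scale (x ^ i) (c i)) = poly p x" for x
    by (simp add: \<phi>_def p_def representation_sum[OF B(1)] representation_scale[OF B(1)] B(2)
        poly_sum poly_monom mult.commute)
  moreover have "\<phi> 0 = 0"
    by (simp add: \<phi>_def representation_zero)
  ultimately have "{x. (\<Sum>i<n. scale (x ^ i) (c i)) = 0} \<subseteq> {x. poly p x = 0}"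
    by (metis (mono_tags, lifting) Collect_mono)
  with inf have "p = 0"
    using poly_roots_finite finite_subset by blast
  then have "coeff p j = 0"
    by simp
  then have "\<phi> (c j) = 0"
    using \<open>j < n\<close> by (simp add: p_def coeff_sum)
  then show False
    by (simp add: \<phi>_def representation_basis[OF B(1) B(3)])
qed

lemma poly_eq_0_if_infinite_zeros:
  assumes "f \<in> polys" "infinite {x. f x = 0}"
  shows "f = 0"
proof -
  obtain n c where f: "f = (\<lambda>x. \<Sum>i<n. scale (x ^ i) (c i))"
    using assms(1) by (elim polysE)
  have "c i = 0" if "i < n" for i
    using poly_coeff_eq_0[OF _ that] assms(2) unfolding f by blast
  then show ?thesis
    unfolding f by (intro ext) simp
qed

lemma infinite_if_MOST: "\<forall>\<^sub>\<infinity>x::'k. P x \<Longrightarrow> infinite {x. P x}"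
  using infinite_field unfolding eventually_cofinite
  by (metis (full_types) Collect_neg_eq finite_Un Compl_partition)

lemma poly_nonzero_MOST: "f \<in> polys \<Longrightarrow> f \<noteq> 0 \<Longrightarrow> \<forall>\<^sub>\<infinity>x. f x \<noteq> 0"
  using poly_eq_0_if_infinite_zeros unfolding eventually_cofinite by auto

lemma poly_eq_if_MOST_eq:
  assumes "f \<in> polys" "g \<in> polys" "\<forall>\<^sub>\<infinity>x. f x = g x"
  shows "f = g"
proof -
  have "f - g = 0"
    using assms infinite_if_MOST[OF assms(3)] by (intro poly_eq_0_if_infinite_zeros) auto
  then show ?thesis
    by simp
qed

lemma polys_no_zero_divisors:
  assumes "f \<in> polys" "g \<in> polys" "f * g = 0"
  shows "f = 0 \<or> g = 0"
proof (rule ccontr)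
  assume "\<not> ?thesis"
  then have "\<forall>\<^sub>\<infinity>x. f x \<noteq> 0" "\<forall>\<^sub>\<infinity>x. g x \<noteq> 0"
    using assms poly_nonzero_MOST by auto
  then have "\<forall>\<^sub>\<infinity>x. (f * g) x \<noteq> 0"
    by eventually_elim simp
  then show False
    using assms(3) infinite_if_MOST by fastforce
qed

lemma scale_power_in_poly_below: "(\<lambda>x. scale (x ^ n) d) \<in> poly_below (Suc n)"
  unfolding poly_below_Suc_iff_top by (intro bexI[of _ 0] exI[of _ d]) auto

lemma polys_scale_power [intro, simp]: "(\<lambda>x. scale (x ^ n) d) \<in> polys"
  unfolding polys_def using scale_power_in_poly_below by blast

lemma poly_below_scale_power: "f \<in> poly_below n \<Longrightarrow> (\<lambda>x. scale (x ^ j) (f x)) \<in> poly_below (n + j)"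
proof (induction j)
  case (Suc j)
  from poly_below_scale[OF Suc.IH[OF Suc.prems]] show ?case
    by (simp add: mult.commute)
qed simp

lemma poly_reduce_degree:
  assumes "f \<in> poly_below (Suc n)" "g \<in> poly_below (Suc m)" "g \<notin> poly_below m" "m \<le> n"
  shows "\<exists>h\<in>polys. f - g * h \<in> poly_below n"
proof -
  obtain f0 c where f: "f0 \<in> poly_below n" "f = (\<lambda>x. f0 x + scale (x ^ n) c)"
    using assms(1) unfolding poly_below_Suc_iff_top by blast
  obtain g0 d where g: "g0 \<in> poly_below m" "g = (\<lambda>x. g0 x + scale (x ^ m) d)"
    using assms(2) unfolding poly_below_Suc_iff_top by blast
  have "d \<noteq> 0"
  proof
    assume "d = 0"
    then have "g = g0"
      by (simp add: g(2))
    with assms(3) g(1) show False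
      by simp
  qed
  define h where "h = (\<lambda>x. scale (x ^ (n - m)) (inverse d * c))"
  have "g * h = g0 * h + (\<lambda>x. scale (x ^ n) c)"
    using \<open>d \<noteq> 0\<close> \<open>m \<le> n\<close>
    by (simp add: g h_def fun_eq_iff distrib_right scale_mult_left scale_mult_right scale_right_distrib
        flip: power_add mult.assoc)
  then have "f - g * h = f0 - g0 * h"
    by (simp add: f fun_eq_iff)
  moreover have "g0 * h \<in> poly_below n"
  proof -
    have "g0 * h = (\<lambda>x. scale (x ^ (n - m)) ((g0 * (\<lambda>_. inverse d * c)) x))"
      by (simp add: h_def fun_eq_iff scale_mult_right)
    then show ?thesis
      using poly_below_scale_power[OF poly_below_const_mult_right[OF g(1)], of "n - m"] \<open>m \<le> n\<close>
      by simp
  qed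
  ultimately show ?thesis
    using poly_below_diff f by (intro bexI[of _ h]) (auto simp: h_def)
qed

text \<open>
  Euclid's algorithm: a common right multiple of \<open>f - g * h\<close> and \<open>g\<close> yields one of \<open>f\<close> and \<open>g\<close>, and
  \<open>h\<close> can be chosen to lower the degree because leading coefficients are invertible.
\<close>

lemma right_Ore_below:
  "f \<in> poly_below n \<Longrightarrow> g \<in> poly_below m \<Longrightarrow>
    \<exists>f'\<in>polys. \<exists>g'\<in>polys. (f' \<noteq> 0 \<or> g' \<noteq> 0) \<and> f * f' = g * g'"
proof (induction "n + m" arbitrary: n m f g rule: less_induct)
  case less
  consider "n = 0" | "m = 0" | n' m' where "n = Suc n'" "m = Suc m'"
    by (cases n; cases m) auto
  then show ?case
  proof cases
    case 1
    then show ?thesis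
      using less.prems by (intro bexI[of _ 1] bexI[of _ 0]) auto
  next
    case 2
    then show ?thesis
      using less.prems by (intro bexI[of _ 0] bexI[of _ 1]) auto
  next
    case (3 n' m')
    show ?thesis
    proof (cases "f \<in> poly_below n' \<or> g \<in> poly_below m'")
      case True
      then show ?thesis
        using less.hyps[of n' m f g] less.hyps[of n m' f g] less.prems 3 by auto
    next
      case False
      show ?thesis
      proof (cases "m' \<le> n'")
        case True
        obtain h where h: "h \<in> polys" "f - g * h \<in> poly_below n'"
          using poly_reduce_degree[of f n' g m'] less.prems 3 False True by blast
        obtain f' g' where *: "f' \<in> polys" "g' \<in> polys" "f' \<noteq> 0 \<or> g' \<noteq> 0" "(f - g * h) * f' = g * g'"
          using less.hyps[OF _ h(2) less.prems(2)] 3 by auto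
        have "f * f' = g * (g' + h * f')"
          using *(4) by (simp add: algebra_simps)
        then show ?thesis
          using * h(1) by (intro bexI[of _ f'] bexI[of _ "g' + h * f'"]) auto
      next
        case le: False
        then obtain h where h: "h \<in> polys" "g - f * h \<in> poly_below m'"
          using poly_reduce_degree[of g m' f n'] less.prems 3 False by force
        obtain f' g' where *: "f' \<in> polys" "g' \<in> polys" "f' \<noteq> 0 \<or> g' \<noteq> 0" "f * f' = (g - f * h) * g'"
          using less.hyps[OF _ less.prems(1) h(2)] 3 by auto
        have "f * (f' + h * g') = g * g'"
          using *(4) by (simp add: algebra_simps)
        then show ?thesis
          using * h(1) by (intro bexI[of _ "f' + h * g'"] bexI[of _ "g'"]) auto
      qed
    qed
  qed
qed

lemma right_Ore:
  assumes "f \<in> polys" "g \<in> polys" "g \<noteq> 0"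
  obtains f' g' where "f' \<in> polys" "g' \<in> polys" "f' \<noteq> 0" "f * f' = g * g'"
proof -
  obtain n m where "f \<in> poly_below n" "g \<in> poly_below m"
    using assms unfolding polys_def by blast
  from right_Ore_below[OF this]
  obtain f' g' where *: "f' \<in> polys" "g' \<in> polys" "f' \<noteq> 0 \<or> g' \<noteq> 0" "f * f' = g * g'"
    by blast
  moreover have "f' \<noteq> 0"
    using polys_no_zero_divisors[of g g'] * assms by auto
  ultimately show ?thesis
    using that by blast
qed

end

section \<open>The opposite algebra\<close>

text \<open>
  Reversal of the multiplication exchanges left and right, so a one-sided statement about all
  division algebras contains its mirror image.
\<close>

datatype 'a opp = Op (unop: 'a)

lemma eq_Op_iff: "a = Op x \<longleftrightarrow> unop a = x"
  by (cases a) auto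

instantiation opp :: (division_ring) division_ring
begin

definition "0 = Op 0"
definition "1 = Op 1"
definition "x + y = Op (unop x + unop y)"
definition "x - y = Op (unop x - unop y)"
definition "- x = Op (- unop x)"
definition "x * y = Op (unop y * unop x)"
definition "inverse x = Op (inverse (unop x))"
definition "x div y = x * inverse (y :: 'a opp)"

instance
  by standard
    (auto simp: zero_opp_def one_opp_def plus_opp_def minus_opp_def uminus_opp_def times_opp_def
      inverse_opp_def divide_opp_def mult.assoc distrib_left distrib_right opp.expand eq_Op_iff)

end

lemma Op_simps:
  "Op 0 = 0" "Op 1 = 1" "Op (x + y) = Op x + Op y" "Op (x - y) = Op x - Op y"
  "Op (x * y) = Op y * Op x" "Op (inverse x) = inverse (Op x)"
  by (simp_all add: zero_opp_def one_opp_def plus_opp_def minus_opp_def times_opp_def inverse_opp_def)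

lemma Op_power: "Op (x ^ n) = Op x ^ n"
  by (induction n) (simp_all add: Op_simps power_commutes)

lemma Op_sum: "Op (sum f A) = (\<Sum>x\<in>A. Op (f x))"
  by (induction A rule: infinite_finite_induct) (simp_all add: Op_simps)

lemma Op_eq_0_iff: "Op x = 0 \<longleftrightarrow> x = 0"
  by (simp add: zero_opp_def)

context infinite_division_algebra
begin

abbreviation opp_scale :: "'k \<Rightarrow> 'd opp \<Rightarrow> 'd opp" where
  "opp_scale c x \<equiv> Op (scale c (unop x))"

lemma opposite_algebra: "infinite_division_algebra opp_scale"
proof
  show "infinite (UNIV :: 'k set)"
    by (rule infinite_field)
qed (auto simp: plus_opp_def times_opp_def scale_left_distrib scale_right_distrib
    scale_mult_left scale_mult_right opp.expand)

lemma poly_below_opposite_iff: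
  "(\<lambda>x. Op (f x)) \<in> infinite_division_algebra.poly_below opp_scale n \<longleftrightarrow> f \<in> poly_below n"
proof -
  have "(\<lambda>x. Op (f x)) \<in> infinite_division_algebra.poly_below opp_scale n \<longleftrightarrow>
      (\<exists>c. (\<lambda>x. Op (f x)) = (\<lambda>x. \<Sum>i<n. Op (scale (x ^ i) (unop (c i)))))"
    by (simp add: infinite_division_algebra.poly_below_def[OF opposite_algebra])
  also have "\<dots> \<longleftrightarrow> (\<exists>c. f = (\<lambda>x. \<Sum>i<n. scale (x ^ i) (unop (c i))))"
    by (simp add: fun_eq_iff flip: Op_sum)
  also have "\<dots> \<longleftrightarrow> (\<exists>c. f = (\<lambda>x. \<Sum>i<n. scale (x ^ i) (c i)))"
  proof
    assume "\<exists>c. f = (\<lambda>x. \<Sum>i<n. scale (x ^ i) (c i))"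
    then obtain c where "f = (\<lambda>x. \<Sum>i<n. scale (x ^ i) (unop (Op (c i))))"
      by auto
    then show "\<exists>c. f = (\<lambda>x. \<Sum>i<n. scale (x ^ i) (unop (c i)))"
      by (rule exI[where P = "\<lambda>c. f = (\<lambda>x. \<Sum>i<n. scale (x ^ i) (unop (c i)))"])
  qed auto
  finally show ?thesis
    by (simp add: poly_below_def)
qed

lemma polys_opposite_iff:
  "(\<lambda>x. Op (f x)) \<in> infinite_division_algebra.polys opp_scale \<longleftrightarrow> f \<in> polys"
  by (simp add: polys_def infinite_division_algebra.polys_def[OF opposite_algebra]
      poly_below_opposite_iff)

lemma left_Ore:
  assumes "f \<in> polys" "g \<in> polys" "g \<noteq> 0"
  obtains f' g' where "f' \<in> polys" "g' \<in> polys" "f' \<noteq> 0" "f' * f = g' * g"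
proof -
  have "(\<lambda>x. Op (g x)) \<noteq> 0"
    using assms(3) by (auto simp: fun_eq_iff Op_eq_0_iff)
  from infinite_division_algebra.right_Ore[OF opposite_algebra _ _ this, of "\<lambda>x. Op (f x)"] assms
  obtain f' g' where *: "f' \<in> infinite_division_algebra.polys opp_scale"
    "g' \<in> infinite_division_algebra.polys opp_scale" "f' \<noteq> 0"
    "(\<lambda>x. Op (f x)) * f' = (\<lambda>x. Op (g x)) * g'"
    by (auto simp: polys_opposite_iff)
  show thesis
  proof (rule that)
    show "(\<lambda>x. unop (f' x)) \<in> polys" "(\<lambda>x. unop (g' x)) \<in> polys"
      using * by (simp_all flip: polys_opposite_iff)
    show "(\<lambda>x. unop (f' x)) \<noteq> 0"
      using *(3) by (auto simp: fun_eq_iff zero_opp_def eq_Op_iff)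
    show "(\<lambda>x. unop (f' x)) * f = (\<lambda>x. unop (g' x)) * g"
      using *(4) by (auto simp: fun_eq_iff times_opp_def)
  qed
qed

section \<open>Rational functions\<close>

text \<open>
  Functions that agree with a right fraction \<open>p q^{-1}\<close> at all but finitely many points. Modulo equality
  outside finite sets they form the division ring of fractions of the polynomial ring, where
  pointwise inversion causes no trouble since a nonzero rational function has finitely many zeros.
\<close>

definition rational :: "('k \<Rightarrow> 'd) \<Rightarrow> bool" where
  "rational f \<longleftrightarrow> (\<exists>p\<in>polys. \<exists>q\<in>polys. q \<noteq> 0 \<and> (\<forall>\<^sub>\<infinity>x. f x * q x = p x))"

lemma rationalI:
  "p \<in> polys \<Longrightarrow> q \<in> polys \<Longrightarrow> q \<noteq> 0 \<Longrightarrow> \<forall>\<^sub>\<infinity>x. f x * q x = p x \<Longrightarrow> rational f"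
  unfolding rational_def by blast

lemma rationalE:
  assumes "rational f"
  obtains p q where "p \<in> polys" "q \<in> polys" "q \<noteq> 0" "\<forall>\<^sub>\<infinity>x. f x * q x = p x"
  using assms unfolding rational_def by blast

lemma rational_poly [intro]: "f \<in> polys \<Longrightarrow> rational f"
  by (rule rationalI[of f 1]) (auto simp: fun_eq_iff)

lemma rational_const [intro, simp]: "rational (\<lambda>_. d)"
  by (intro rational_poly polys_const)

lemma rational_zero [intro, simp]: "rational 0"
  by (intro rational_poly polys_zero)

lemma rational_zero_or_nonzero:
  assumes "rational f"
  shows "(\<forall>\<^sub>\<infinity>x. f x = 0) \<or> (\<forall>\<^sub>\<infinity>x. f x \<noteq> 0)"
proof -
  obtain p q where *: "p \<in> polys" "q \<in> polys" "q \<noteq> 0" "\<forall>\<^sub>\<infinity>x. f x * q x = p x"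
    using assms by (rule rationalE)
  have q: "\<forall>\<^sub>\<infinity>x. q x \<noteq> 0"
    using * by (intro poly_nonzero_MOST)
  show ?thesis
  proof (cases "p = 0")
    case True
    have "\<forall>\<^sub>\<infinity>x. f x = 0"
      using q *(4) by eventually_elim (auto simp: True)
    then show ?thesis ..
  next
    case False
    have "\<forall>\<^sub>\<infinity>x. f x \<noteq> 0"
      using poly_nonzero_MOST[OF *(1) False] *(4) by eventually_elim auto
    then show ?thesis ..
  qed
qed

lemma polys_mult_nonzero:
  "f \<in> polys \<Longrightarrow> g \<in> polys \<Longrightarrow> f \<noteq> 0 \<Longrightarrow> g \<noteq> 0 \<Longrightarrow> f * g \<noteq> 0"
  using polys_no_zero_divisors by blast

lemma rational_add [intro]:
  assumes "rational f" "rational g"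
  shows "rational (f + g)"
proof -
  obtain p q where f: "p \<in> polys" "q \<in> polys" "q \<noteq> 0" "\<forall>\<^sub>\<infinity>x. f x * q x = p x"
    using assms(1) by (rule rationalE)
  obtain p' q' where g: "p' \<in> polys" "q' \<in> polys" "q' \<noteq> 0" "\<forall>\<^sub>\<infinity>x. g x * q' x = p' x"
    using assms(2) by (rule rationalE)
  obtain y z where Ore: "y \<in> polys" "z \<in> polys" "y \<noteq> 0" "q * y = q' * z"
    using right_Ore[OF f(2) g(2,3)] .
  have "\<forall>\<^sub>\<infinity>x. (f + g) x * (q * y) x = (p * y + p' * z) x"
    using f(4) g(4)
  proof eventually_elim
    case (elim x)
    have "q x * y x = q' x * z x"
      using fun_cong[OF Ore(4), of x] by simp
    then have "(f + g) x * (q * y) x = f x * q x * y x + g x * q' x * z x"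
      by (simp add: distrib_right mult.assoc)
    then show ?case
      using elim by simp
  qed
  then show ?thesis
    using f g Ore polys_mult_nonzero[of q y] by (intro rationalI[of "p * y + p' * z" "q * y"]) auto
qed

lemma rational_mult [intro]:
  assumes "rational f" "rational g"
  shows "rational (f * g)"
proof -
  obtain p q where f: "p \<in> polys" "q \<in> polys" "q \<noteq> 0" "\<forall>\<^sub>\<infinity>x. f x * q x = p x"
    using assms(1) by (rule rationalE)
  obtain p' q' where g: "p' \<in> polys" "q' \<in> polys" "q' \<noteq> 0" "\<forall>\<^sub>\<infinity>x. g x * q' x = p' x"
    using assms(2) by (rule rationalE)
  obtain y z where Ore: "y \<in> polys" "z \<in> polys" "y \<noteq> 0" "p' * y = q * z"
    using right_Ore[OF g(1) f(2,3)] .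
  have "\<forall>\<^sub>\<infinity>x. (f * g) x * (q' * y) x = (p * z) x"
    using f(4) g(4)
  proof eventually_elim
    case (elim x)
    have "(f * g) x * (q' * y) x = f x * (g x * q' x) * y x"
      by (simp add: mult.assoc)
    also have "\<dots> = f x * (p' * y) x"
      using elim by (simp add: mult.assoc)
    also have "\<dots> = (f x * q x) * z x"
      by (simp add: Ore(4) mult.assoc)
    finally show ?case
      using elim by simp
  qed
  then show ?thesis
    using f g Ore polys_mult_nonzero[of q' y] by (intro rationalI[of "p * z" "q' * y"]) auto
qed

lemma rational_diff [intro]: "rational f \<Longrightarrow> rational g \<Longrightarrow> rational (f - g)"
  using rational_add[of f "(\<lambda>_. - 1) * g"] rational_mult[of "\<lambda>_. - 1" g]
  by (simp add: fun_diff_def plus_fun_def times_fun_def)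

lemma rational_inverse [intro]:
  assumes "rational f"
  shows "rational (\<lambda>x. inverse (f x))"
proof -
  obtain p q where f: "p \<in> polys" "q \<in> polys" "q \<noteq> 0" "\<forall>\<^sub>\<infinity>x. f x * q x = p x"
    using assms by (rule rationalE)
  show ?thesis
  proof (cases "p = 0")
    case True
    have "\<forall>\<^sub>\<infinity>x. inverse (f x) * 1 x = 0 x"
      using f(4) poly_nonzero_MOST[OF f(2,3)] by eventually_elim (auto simp: True)
    then show ?thesis
      by (intro rationalI[of 0 1]) auto
  next
    case False
    have "\<forall>\<^sub>\<infinity>x. inverse (f x) * p x = q x"
      using f(4) poly_nonzero_MOST[OF f(1) False]
    proof eventually_elim
      case (elim x)
      then have "f x \<noteq> 0"
        by auto
      then show ?case
        by (simp flip: elim(1) mult.assoc)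
    qed
    then show ?thesis
      using f False by (intro rationalI[of q p]) auto
  qed
qed

lemma rational_sum: "(\<And>i. i \<in> A \<Longrightarrow> rational (f i)) \<Longrightarrow> rational (\<Sum>i\<in>A. f i)"
  by (induction A rule: infinite_finite_induct) auto

text \<open>
  If \<open>y * p = z * q\<close>, then \<open>p q^{-1} = y^{-1} z\<close>.
\<close>

lemma rational_left_denominator:
  assumes "rational f"
  obtains p q where "p \<in> polys" "q \<in> polys" "q \<noteq> 0" "\<forall>\<^sub>\<infinity>x. q x * f x = p x"
proof -
  obtain p q where f: "p \<in> polys" "q \<in> polys" "q \<noteq> 0" "\<forall>\<^sub>\<infinity>x. f x * q x = p x"
    using assms by (rule rationalE)
  obtain y z where Ore: "y \<in> polys" "z \<in> polys" "y \<noteq> 0" "y * p = z * q"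
    using left_Ore[OF f(1-3)] .
  have "\<forall>\<^sub>\<infinity>x. y x * f x = z x"
    using f(4) poly_nonzero_MOST[OF f(2,3)]
  proof eventually_elim
    case (elim x)
    have "y x * f x * q x = z x * q x"
      using fun_cong[OF Ore(4), of x] elim by (simp add: mult.assoc)
    then show ?case
      using elim by simp
  qed
  then show thesis
    using that Ore by blast
qed

lemma rational_common_left_denominator:
  assumes "finite A" "\<And>i. i \<in> A \<Longrightarrow> rational (f i)"
  shows "\<exists>q\<in>polys. q \<noteq> 0 \<and> (\<forall>i\<in>A. \<exists>p\<in>polys. \<forall>\<^sub>\<infinity>x. q x * f i x = p x)"
  using assms
proof (induction A rule: finite_induct)
  case empty
  show ?case
    by (intro bexI[of _ 1]) (auto simp: fun_eq_iff)
next
  case (insert j A)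
  then obtain q where q: "q \<in> polys" "q \<noteq> 0" "\<forall>i\<in>A. \<exists>p\<in>polys. \<forall>\<^sub>\<infinity>x. q x * f i x = p x"
    by blast
  have "rational (q * f j)"
    using insert.prems q(1) by auto
  then obtain p' q' where q': "p' \<in> polys" "q' \<in> polys" "q' \<noteq> 0" "\<forall>\<^sub>\<infinity>x. q' x * (q * f j) x = p' x"
    by (rule rational_left_denominator)
  have "\<exists>p\<in>polys. \<forall>\<^sub>\<infinity>x. (q' * q) x * f i x = p x" if "i \<in> insert j A" for i
  proof (cases "i = j")
    case True
    then show ?thesis
      using q' by (intro bexI[of _ p']) (simp_all add: mult.assoc)
  next
    case False
    with that have "i \<in> A"
      by simp
    with q(3) obtain p where p: "p \<in> polys" "\<forall>\<^sub>\<infinity>x. q x * f i x = p x"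
      by (elim ballE bexE) auto
    from p(2) have "\<forall>\<^sub>\<infinity>x. (q' * q) x * f i x = (q' * p) x"
      by eventually_elim (simp add: mult.assoc)
    then show ?thesis
      using p(1) q'(2) by (intro bexI[of _ "q' * p"]) (assumption, rule polys_mult)
  qed
  then have "\<forall>i\<in>insert j A. \<exists>p\<in>polys. \<forall>\<^sub>\<infinity>x. (q' * q) x * f i x = p x" by (rule ballI)
  moreover have "q' * q \<noteq> 0" "q' * q \<in> polys"
    by (rule polys_mult_nonzero[OF q'(2) q(1) q'(3) q(2)], rule polys_mult[OF q'(2) q(1)])
  ultimately show ?case
    by (intro bexI[of _ "q' * q"] conjI)
qed

end

section \<open>Linear independence of words\<close>

fun iterated_word :: "'q::ring_1 \<Rightarrow> ('i \<Rightarrow> 'q) \<Rightarrow> 'i list \<Rightarrow> 'q" where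
  "iterated_word y b [] = y"
| "iterated_word y b (i # I) = y * b i * iterated_word y b I"

text \<open>
  Think of \<open>l = \<lambda> - a\<close> with a central variable \<open>\<lambda>\<close>, of \<open>K / Z\<close> as a division ring of coefficients
  that do not involve \<open>\<lambda>\<close>, and of \<open>N\<close> as the elements that are polynomial in \<open>\<lambda>\<close>. The ideal \<open>Z\<close> of
  null elements is part of the statement because rational functions are only compared up to
  finitely many points. The induction is on the length of the longest words in the relation and
  then on the number of such words with a nonnull coefficient. Since \<open>l * y = 1\<close>, multiplication of
  \<open>d * y * b i * W\<close> by \<open>l\<close> gives \<open>d * b i * W\<close> up to the error \<open>- [a, d] * y * b i * W\<close>; after
  normalization of one leading coefficient to \<open>1\<close>, whose commutator with \<open>a\<close> vanishes, the new
  relation is smaller.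
\<close>

lemma iterated_words_independent:
  fixes a l y :: "'q::ring_1" and b :: "'i::finite \<Rightarrow> 'q" and K Z N :: "'q set"
  assumes K_ring: "1 \<in> K" "\<And>d e. d \<in> K \<Longrightarrow> e \<in> K \<Longrightarrow> d - e \<in> K" "\<And>d e. d \<in> K \<Longrightarrow> e \<in> K \<Longrightarrow> d * e \<in> K"
    and Z_ideal: "0 \<in> Z" "\<And>d e. d \<in> Z \<Longrightarrow> e \<in> Z \<Longrightarrow> d - e \<in> Z"
      "\<And>d z. d \<in> K \<Longrightarrow> z \<in> Z \<Longrightarrow> d * z \<in> Z" "\<And>d z. d \<in> K \<Longrightarrow> z \<in> Z \<Longrightarrow> z * d \<in> Z"
    and quotient_division: "\<And>d. d \<in> K \<Longrightarrow> d \<notin> Z \<Longrightarrow> \<exists>d'\<in>K. d' * d - 1 \<in> Z"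
    and N_module: "K \<subseteq> N" "\<And>m n. m \<in> N \<Longrightarrow> n \<in> N \<Longrightarrow> m - n \<in> N"
      "\<And>d n. d \<in> K \<Longrightarrow> n \<in> N \<Longrightarrow> d * n \<in> N" "\<And>n. n \<in> N \<Longrightarrow> l * n \<in> N"
    and Z_mult: "\<And>z q. z \<in> Z \<Longrightarrow> z * q \<in> N"
    and y: "l * y = 1" "y \<notin> N"
    and l: "\<And>d. d \<in> K \<Longrightarrow> l * d - d * l = d * a - a * d"
    and "a \<in> K" "\<And>i. b i \<in> K"
    and b: "\<And>u e. u \<in> K \<Longrightarrow> (\<And>i. e i \<in> K) \<Longrightarrow> (\<And>i. a * e i - e i * a \<in> Z) \<Longrightarrow>
      a * u - u * a - (\<Sum>i\<in>UNIV. e i * b i) \<in> Z \<Longrightarrow> (\<And>i. e i \<in> Z)"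
    and d: "\<And>I. d I \<in> K" and rel: "(\<Sum>I | length I \<le> n. d I * iterated_word y b I) \<in> N"
    and "length I \<le> n"
  shows "d I \<in> Z"
proof -
  let ?W = "iterated_word y b"
  have fin: "finite {I :: 'i list. length I \<le> n}" for n
    using finite_lists_length_le[of "UNIV :: 'i set" n] by simp
  have fin': "finite {I :: 'i list. length I = n}" for n
    using finite_lists_length_eq[of "UNIV :: 'i set" n] by simp
  have K0: "0 \<in> K"
    using K_ring(1) K_ring(2)[of 1 1] by simp
  note Z0 = Z_ideal(1)
  have K_add: "d + e \<in> K" if "d \<in> K" "e \<in> K" for d e
    using K_ring(2)[OF that(1) K_ring(2)[OF K0 that(2)]] by simp
  have N0: "0 \<in> N"
    using K0 N_module(1) by blast
  have N_add: "m + n \<in> N" if "m \<in> N" "n \<in> N" for m n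
    using N_module(2)[OF that(1) N_module(2)[OF N0 that(2)]] by simp
  have K_sum: "sum f A \<in> K" if "\<And>i. i \<in> A \<Longrightarrow> f i \<in> K" for f and A :: "'j set"
    using that by (induction A rule: infinite_finite_induct) (auto simp: K0 K_add)
  have N_sum: "sum f A \<in> N" if "\<And>i. i \<in> A \<Longrightarrow> f i \<in> N" for f and A :: "'i list set"
    using that by (induction A rule: infinite_finite_induct) (auto simp: N0 N_add)
  have one_notin: "1 \<notin> Z"
    using Z_mult[of 1 y] y(2) by auto

  define nonnull where "nonnull n d = {I :: 'i list. length I = n \<and> d I \<notin> Z}" for n and d :: "'i list \<Rightarrow> 'q"
  have main: "\<forall>I. length I \<le> n \<longrightarrow> d I \<in> Z"
    if "\<And>I. d I \<in> K" "(\<Sum>I | length I \<le> n. d I * ?W I) \<in> N" for n d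
    using that
  proof (induction "(n, card (nonnull n d))" arbitrary: n d rule: wf_induct_rule[OF wf_lex_prod[OF wf_less_than wf_less_than]])
    case (1 n d)
    have fin_nn: "finite (nonnull n d)"
      unfolding nonnull_def by (rule finite_subset[OF _ fin'[of n]]) auto
    show ?case
    proof (cases "nonnull n d = {}")
      case True
      then have top: "d I \<in> Z" if "length I = n" for I
        using that by (auto simp: nonnull_def)
      show ?thesis
      proof (cases n)
        case 0
        then show ?thesis
          using top by auto
      next
        case (Suc m)
        have split: "{I :: 'i list. length I \<le> n} = {I. length I \<le> m} \<union> {I. length I = n}"
          using Suc by auto
        have "(\<Sum>I | length I \<le> n. d I * ?W I) =
            (\<Sum>I | length I \<le> m. d I * ?W I) + (\<Sum>I | length I = n. d I * ?W I)"
          unfolding split by (rule sum.union_disjoint) (use Suc in \<open>auto simp: fin fin'\<close>)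
        then have eq: "(\<Sum>I | length I \<le> m. d I * ?W I) =
            (\<Sum>I | length I \<le> n. d I * ?W I) - (\<Sum>I | length I = n. d I * ?W I)"
          by simp
        have "(\<Sum>I | length I \<le> m. d I * ?W I) \<in> N"
          unfolding eq by (intro N_module(2) 1(3) N_sum Z_mult) (simp add: top)
        with 1(1)[of m d] 1(2) Suc have "\<forall>I. length I \<le> m \<longrightarrow> d I \<in> Z"
          by auto
        then show ?thesis
          using top Suc by (auto simp: le_Suc_eq)
      qed
    next
      case False
      then obtain I0 where I0: "length I0 = n" "d I0 \<notin> Z"
        by (auto simp: nonnull_def)
      obtain d' where d': "d' \<in> K" "d' * d I0 - 1 \<in> Z"
        using quotient_division[OF 1(2) I0(2)] by blast
      \<comment> \<open>The relation multiplied by an inverse of \<open>d I0\<close>; its coefficient at \<open>I0\<close> is \<open>1\<close> modulo \<open>Z\<close>.\<close>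
      define f where "f I = (if length I \<le> n then d' * d I else 0)" for I
      have f: "f I \<in> K" for I
        by (simp add: f_def K0 K_ring d' 1(2))
      have f_rel: "(\<Sum>I | length I \<le> n. f I * ?W I) \<in> N"
      proof -
        have "(\<Sum>I | length I \<le> n. f I * ?W I) = d' * (\<Sum>I | length I \<le> n. d I * ?W I)"
          by (simp add: f_def sum_distrib_left mult.assoc)
        then show ?thesis
          using N_module(3)[OF d'(1) 1(3)] by simp
      qed
      define T where "T x = a * x - x * a" for x
      \<comment> \<open>The coefficients of the relation after multiplication by \<open>l\<close>.\<close>
      define g where "g I = (\<Sum>i\<in>UNIV. f (i # I) * b i) - T (f I)" for I
      have T: "T x \<in> K" if "x \<in> K" for x
        using that by (simp add: T_def K_ring \<open>a \<in> K\<close>)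
      have T_Z: "T x \<in> Z" if "x \<in> Z" for x
        using that by (simp add: T_def Z_ideal \<open>a \<in> K\<close>)
      have g: "g I \<in> K" for I
        unfolding g_def by (intro K_ring K_sum T f) (use \<open>\<And>i. b i \<in> K\<close> in auto)
      have shift: "l * (x * ?W I) = (case I of [] \<Rightarrow> x | i # J \<Rightarrow> x * b i * ?W J) - T x * ?W I"
        if "x \<in> K" for x I
      proof -
        have "l * x = x * l - T x"
          using l[OF that] by (simp add: T_def algebra_simps)
        then have "l * (x * ?W I) = (x * l - T x) * ?W I"
          by (simp flip: mult.assoc)
        then have "l * (x * ?W I) = x * (l * ?W I) - T x * ?W I"
          by (simp only: left_diff_distrib mult.assoc)
        moreover have "l * ?W I = (case I of [] \<Rightarrow> 1 | i # J \<Rightarrow> b i * ?W J)"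
          using y(1) by (cases I) (simp_all flip: mult.assoc)
        ultimately show ?thesis
          by (cases I) (simp_all add: mult.assoc)
      qed
      have g_rel: "(\<Sum>I | length I \<le> n. g I * ?W I) \<in> N"
      proof -
        \<comment> \<open>The empty word contributes \<open>f []\<close> outside the words, an element of \<open>K\<close> and hence of \<open>N\<close>.\<close>
        have "l * (\<Sum>I | length I \<le> n. f I * ?W I) =
            (\<Sum>I | length I \<le> n. case I of [] \<Rightarrow> f [] | i # J \<Rightarrow> f I * b i * ?W J) -
            (\<Sum>I | length I \<le> n. T (f I) * ?W I)"
          by (simp add: sum_distrib_left shift f flip: sum_subtractf)
             (intro sum.cong refl arg_cong2[where f = "(-)"], auto split: list.splits)
        also have "(\<Sum>I | length I \<le> n. case I of [] \<Rightarrow> f [] | i # J \<Rightarrow> f I * b i * ?W J) =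
            f [] + (\<Sum>I | length I \<le> n. (\<Sum>i\<in>UNIV. f (i # I) * b i) * ?W I)"
        proof -
          have "{I :: 'i list. length I \<le> n} = insert [] ((\<lambda>(I, i). i # I) ` ({I. Suc (length I) \<le> n} \<times> UNIV))"
            by (auto simp: image_iff) (metis length_Cons neq_Nil_conv)
          moreover have "finite ((\<lambda>(I, i). i # I) ` ({I :: 'i list. Suc (length I) \<le> n} \<times> (UNIV :: 'i set)))"
            by (intro finite_imageI finite_cartesian_product) (auto intro: finite_subset[OF _ fin[of n]])
          ultimately have "(\<Sum>I | length I \<le> n. case I of [] \<Rightarrow> f [] | i # J \<Rightarrow> f I * b i * ?W J) =
              f [] + (\<Sum>I\<in>(\<lambda>(I, i). i # I) ` ({I. Suc (length I) \<le> n} \<times> UNIV).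
                 case I of [] \<Rightarrow> f [] | i # J \<Rightarrow> f I * b i * ?W J)"
            by (simp add: image_iff split_beta)
          also have "(\<Sum>I\<in>(\<lambda>(I, i). i # I) ` ({I. Suc (length I) \<le> n} \<times> UNIV).
                 case I of [] \<Rightarrow> f [] | i # J \<Rightarrow> f I * b i * ?W J) =
              (\<Sum>(I, i)\<in>{I. Suc (length I) \<le> n} \<times> UNIV. f (i # I) * b i * ?W I)"
            by (subst sum.reindex) (auto simp: inj_on_def split_beta)
          also have "\<dots> = (\<Sum>I | Suc (length I) \<le> n. \<Sum>i\<in>UNIV. f (i # I) * b i * ?W I)"
            by (rule sum.cartesian_product[symmetric])
          also have "\<dots> = (\<Sum>I | length I \<le> n. \<Sum>i\<in>UNIV. f (i # I) * b i * ?W I)"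
            by (rule sum.mono_neutral_left) (auto simp: fin f_def)
          finally show ?thesis
            by (simp add: sum_distrib_right)
        qed
        finally have "(\<Sum>I | length I \<le> n. g I * ?W I) =
            l * (\<Sum>I | length I \<le> n. f I * ?W I) - f []"
          by (simp add: g_def left_diff_distrib sum_subtractf)
        then show ?thesis
          using N_module f_rel f[of "[]"] by auto
      qed
      have f_I0: "f I0 - 1 \<in> Z"
        using d' I0 by (simp add: f_def)
      have "T (f I0) = T (f I0 - 1)"
        by (simp add: T_def algebra_simps)
      then have "T (f I0) \<in> Z"
        using T_Z[OF f_I0] by simp
      have g_top: "g I = 0 - T (f I)" if "length I = n" for I
        using that by (simp add: g_def f_def)
      have "nonnull n g \<subseteq> nonnull n d - {I0}"
      proof
        fix I
        assume "I \<in> nonnull n g"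
        then have I: "length I = n" "g I \<notin> Z"
          by (auto simp: nonnull_def)
        then have "T (f I) \<notin> Z"
          using Z_ideal(2)[OF Z0] g_top by auto
        then have "I \<noteq> I0" "f I \<notin> Z"
          using \<open>T (f I0) \<in> Z\<close> T_Z by auto
        then show "I \<in> nonnull n d - {I0}"
          using I Z_ideal(3)[OF d'(1)] by (auto simp: nonnull_def f_def)
      qed
      moreover have "I0 \<in> nonnull n d"
        using I0 by (simp add: nonnull_def)
      ultimately have "card (nonnull n g) < card (nonnull n d)"
        using fin_nn by (intro psubset_card_mono) auto
      with 1(1)[of n g] g g_rel have g_Z: "g I \<in> Z" if "length I \<le> n" for I
        using that by auto
      have "f I0 \<in> Z"
      proof (cases I0)
        case Nil
        then have "f [] * y \<in> N"
          using f_rel I0 by simp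
        moreover have "(f [] - 1) * y \<in> N"
          using Z_mult[OF f_I0] Nil by simp
        ultimately have "f [] * y - (f [] - 1) * y \<in> N"
          by (rule N_module(2))
        then show ?thesis
          using y(2) by (simp add: algebra_simps)
      next
        case (Cons i J)
        have "(\<Sum>i\<in>UNIV. f (i # J) * b i) - T (f J) \<in> Z"
          using g_Z[of J] I0 Cons by (simp add: g_def)
        from Z_ideal(2)[OF Z0 this] have "a * f J - f J * a - (\<Sum>i\<in>UNIV. f (i # J) * b i) \<in> Z"
          by (simp add: T_def)
        moreover have "a * f (i # J) - f (i # J) * a \<in> Z" for i
        proof -
          have "0 - g (i # J) \<in> Z"
            using g_Z[of "i # J"] I0 Cons by (intro Z_ideal(2) Z0) simp
          then show ?thesis
            using g_top[of "i # J"] I0 Cons by (simp add: T_def)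
        qed
        ultimately show ?thesis
          unfolding Cons using b[of "f J" "\<lambda>i. f (i # J)" i] f by blast
      qed
      then have "f I0 - (f I0 - 1) \<in> Z"
        using f_I0 by (rule Z_ideal(2))
      then show ?thesis
        using one_notin by simp
    qed
  qed
  show ?thesis
    using main[OF d rel] \<open>length I \<le> n\<close> by blast
qed

section \<open>Commutators and resolvents\<close>

lemma unop_1: "unop 1 = 1"
  by (simp add: one_opp_def)

lemma zero_in_centralizer [simp]: "0 \<in> centralizer a"
  by (simp add: centralizer_def)

lemma left_algebraic_eltI:
  assumes "\<And>i. i < n \<Longrightarrow> c i \<in> E" "i < n" "c i \<noteq> 0" "(\<Sum>i<n. c i * b ^ i) = 0"
  shows "left_algebraic_elt E b"
proof -
  obtain m where n: "n = Suc m"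
    using assms(2) by (cases n) auto
  show ?thesis
    unfolding left_algebraic_elt_def
    by (rule exI[of _ m], rule exI[of _ c]) (use assms in \<open>auto simp: n lessThan_Suc_atMost less_Suc_eq_le\<close>)
qed

lemma right_algebraic_eltI:
  assumes "\<And>i. i < n \<Longrightarrow> c i \<in> E" "i < n" "c i \<noteq> 0" "(\<Sum>i<n. b ^ i * c i) = 0"
  shows "right_algebraic_elt E b"
proof -
  obtain m where n: "n = Suc m"
    using assms(2) by (cases n) auto
  show ?thesis
    unfolding right_algebraic_elt_def
    by (rule exI[of _ m], rule exI[of _ c]) (use assms in \<open>auto simp: n lessThan_Suc_atMost less_Suc_eq_le\<close>)
qed

lemma sum_lessThan_double: "(\<Sum>i<2 * n. f i) = (\<Sum>i<n. f (2 * i) + f (2 * i + 1))"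
  for f :: "nat \<Rightarrow> 'a::comm_monoid_add"
  by (induction n) (simp_all add: add.assoc)

text \<open>
  The even powers of \<open>b\<close> carry the \<open>c i\<close>, the odd ones the \<open>d i\<close>.
\<close>

lemma not_left_algebraic_square:
  fixes b :: "'a::ring_1"
  assumes "\<not> left_algebraic_elt E b" "\<And>i. i < n \<Longrightarrow> c i \<in> E" "\<And>i. i < n \<Longrightarrow> d i \<in> E"
    and "(\<Sum>i<n. (c i + d i * b) * (b ^ 2) ^ i) = 0" "i < n"
  shows "c i = 0 \<and> d i = 0"
proof (rule ccontr)
  define e where "e j = (if even j then c (j div 2) else d (j div 2))" for j
  assume "\<not> ?thesis"
  then have "e (2 * i) \<noteq> 0 \<or> e (2 * i + 1) \<noteq> 0"
    by (simp add: e_def)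
  moreover have "2 * i < 2 * n" "2 * i + 1 < 2 * n"
    using \<open>i < n\<close> by simp_all
  ultimately obtain j where "j < 2 * n" "e j \<noteq> 0"
    by blast
  moreover have "e j \<in> E" if "j < 2 * n" for j
    using that assms(2,3) by (auto simp: e_def)
  moreover have "(\<Sum>j<2 * n. e j * b ^ j) = 0"
    using assms(4)
    by (simp add: sum_lessThan_double e_def distrib_right power_mult mult.assoc flip: power_mult)
  ultimately show False
    using left_algebraic_eltI[of "2 * n" e E j b] assms(1) by blast
qed

lemma not_right_algebraic_square:
  fixes b :: "'a::ring_1"
  assumes "\<not> right_algebraic_elt E b" "0 \<in> E" "\<And>i. i < n \<Longrightarrow> c i \<in> E"
    and "(\<Sum>i<n. (b ^ 2) ^ i * c i) = 0" "i < n"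
  shows "c i = 0"
proof (rule ccontr)
  define e where "e j = (if even j then c (j div 2) else 0)" for j
  assume "c i \<noteq> 0"
  then have "2 * i < 2 * n" "e (2 * i) \<noteq> 0"
    using \<open>i < n\<close> by (simp_all add: e_def)
  moreover have "e j \<in> E" if "j < 2 * n" for j
    using that assms(2,3) by (auto simp: e_def)
  moreover have "(\<Sum>j<2 * n. b ^ j * e j) = 0"
    using assms(4) by (simp add: sum_lessThan_double e_def power_mult)
  ultimately show False
    using right_algebraic_eltI[of "2 * n" e E "2 * i" b] assms(1) by blast
qed

context infinite_division_algebra
begin

text \<open>
  For a monic element \<open>p\<close> of minimal degree, \<open>p a - a p\<close> belongs to the ideal and has smaller degree,
  so it vanishes.
\<close>

lemma left_ideal_commuting_element:
  assumes "J \<subseteq> polys" "f \<in> J" "f \<noteq> 0"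
    and diff: "\<And>p q. p \<in> J \<Longrightarrow> q \<in> J \<Longrightarrow> p - q \<in> J"
    and left: "\<And>p d. p \<in> J \<Longrightarrow> (\<lambda>_. d) * p \<in> J"
    and right: "\<And>p. p \<in> J \<Longrightarrow> p * (\<lambda>_. a) \<in> J"
  shows "\<exists>p\<in>J. p \<noteq> 0 \<and> (\<forall>x. p x * a = a * p x)"
proof -
  define has where "has n \<longleftrightarrow> (\<exists>p\<in>J. p \<noteq> 0 \<and> p \<in> poly_below n)" for n
  obtain m where "f \<in> poly_below m"
    using assms(1,2) by (auto simp: polys_def)
  then have "has m"
    using assms(2,3) by (auto simp: has_def)
  define n where "n = (LEAST n. has n)"
  have "has n"
    unfolding n_def using \<open>has m\<close> by (rule LeastI)
  have least: "p = 0" if "p \<in> J" "p \<in> poly_below i" "i < n" for p i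
    using not_less_Least[of i has] that by (auto simp: n_def has_def)
  obtain p where p: "p \<in> J" "p \<noteq> 0" "p \<in> poly_below n"
    using \<open>has n\<close> by (auto simp: has_def)
  then obtain i where n: "n = Suc i"
    by (cases n) auto
  obtain g c where g: "g \<in> poly_below i" "p = (\<lambda>x. g x + scale (x ^ i) c)"
    using p(3) unfolding n poly_below_Suc_iff_top by blast
  have "c \<noteq> 0"
  proof
    assume "c = 0"
    then have "p = g"
      by (simp add: g(2))
    then show False
      using least[of p i] p(1,2) g(1) n by simp
  qed
  define q where "q = (\<lambda>_. inverse c) * p"
  have q_eq: "q = (\<lambda>x. (inverse c * g x) + scale (x ^ i) 1)"
    using \<open>c \<noteq> 0\<close> by (simp add: q_def g fun_eq_iff distrib_left scale_mult_right)
  have "q \<in> J"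
    unfolding q_def by (rule left) (rule p)
  then have "q * (\<lambda>_. a) - (\<lambda>_. a) * q \<in> J"
    by (intro diff left right)
  moreover have "q * (\<lambda>_. a) - (\<lambda>_. a) * q =
      ((\<lambda>_. inverse c) * g) * (\<lambda>_. a) - (\<lambda>_. a) * ((\<lambda>_. inverse c) * g)"
    by (simp add: q_eq fun_eq_iff distrib_left distrib_right scale_mult_left scale_mult_right)
  moreover have "\<dots> \<in> poly_below i"
    by (intro poly_below_diff poly_below_const_mult_left poly_below_const_mult_right g)
  ultimately have "q * (\<lambda>_. a) - (\<lambda>_. a) * q = 0"
    using n by (intro least[where i = i]) simp_all
  then have "\<forall>x. q x * a = a * q x"
    by (simp add: fun_eq_iff)
  moreover have "q \<noteq> 0"
    using p(2) \<open>c \<noteq> 0\<close> by (auto simp: q_def fun_eq_iff)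
  ultimately show ?thesis
    using \<open>q \<in> J\<close> by blast
qed

lemma right_ideal_commuting_element:
  assumes "J \<subseteq> polys" "f \<in> J" "f \<noteq> 0"
    and diff: "\<And>p q. p \<in> J \<Longrightarrow> q \<in> J \<Longrightarrow> p - q \<in> J"
    and right: "\<And>p d. p \<in> J \<Longrightarrow> p * (\<lambda>_. d) \<in> J"
    and left: "\<And>p. p \<in> J \<Longrightarrow> (\<lambda>_. a) * p \<in> J"
  shows "\<exists>p\<in>J. p \<noteq> 0 \<and> (\<forall>x. p x * a = a * p x)"
proof -
  define J' where "J' = (\<lambda>p x. Op (p x)) ` J"
  have "\<exists>p\<in>J'. p \<noteq> 0 \<and> (\<forall>x. p x * Op a = Op a * p x)"
  proof (rule infinite_division_algebra.left_ideal_commuting_element[OF opposite_algebra])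
    show "J' \<subseteq> infinite_division_algebra.polys opp_scale"
      using assms(1) by (auto simp: J'_def polys_opposite_iff)
    show "(\<lambda>x. Op (f x)) \<in> J'"
      using assms(2) by (simp add: J'_def)
    show "(\<lambda>x. Op (f x)) \<noteq> 0"
      using assms(3) by (auto simp: fun_eq_iff Op_eq_0_iff)
  next
    fix p q assume "p \<in> J'" "q \<in> J'"
    then obtain p0 q0 where "p0 \<in> J" "p = (\<lambda>x. Op (p0 x))" "q0 \<in> J" "q = (\<lambda>x. Op (q0 x))"
      by (auto simp: J'_def)
    then show "p - q \<in> J'"
      unfolding J'_def by (intro image_eqI[of _ _ "p0 - q0"]) (auto simp: fun_eq_iff Op_simps intro: diff)
  next
    fix p d assume "p \<in> J'"
    then obtain p0 where "p0 \<in> J" "p = (\<lambda>x. Op (p0 x))"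
      by (auto simp: J'_def)
    then show "(\<lambda>_. d) * p \<in> J'"
      unfolding J'_def
      by (intro image_eqI[of _ _ "p0 * (\<lambda>_. unop d)"]) (auto simp: fun_eq_iff Op_simps intro: right)
  next
    fix p assume "p \<in> J'"
    then obtain p0 where "p0 \<in> J" "p = (\<lambda>x. Op (p0 x))"
      by (auto simp: J'_def)
    then show "p * (\<lambda>_. Op a) \<in> J'"
      unfolding J'_def
      by (intro image_eqI[of _ _ "(\<lambda>_. a) * p0"]) (auto simp: fun_eq_iff Op_simps intro: left)
  qed
  then show ?thesis
    by (auto simp: J'_def fun_eq_iff Op_eq_0_iff simp flip: Op_simps)
qed

lemma commuting_coefficients:
  assumes "\<forall>x. (\<Sum>j<n. scale (x ^ j) (c j)) * a = a * (\<Sum>j<n. scale (x ^ j) (c j))" "i < n"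
  shows "c i \<in> centralizer a"
proof -
  have "(\<Sum>j<n. scale (x ^ j) (c j * a - a * c j)) = 0" for x
    using assms(1)[rule_format, of x]
    by (simp add: scale_right_diff_distrib sum_subtractf sum_distrib_left sum_distrib_right
        scale_mult_left scale_mult_right)
  then have "{x. (\<Sum>j<n. scale (x ^ j) (c j * a - a * c j)) = 0} = UNIV"
    by simp
  then have "c i * a - a * c i = 0"
    using poly_coeff_eq_0[of "\<lambda>j. c j * a - a * c j" n i] infinite_field assms(2) by simp
  then show ?thesis
    by (simp add: centralizer_def)
qed

lemma commuting_poly_coefficients:
  assumes "p \<in> polys" "\<forall>x. p x * a = a * p x"
  obtains n c where "p = (\<lambda>x. \<Sum>i<n. scale (x ^ i) (c i))" "\<And>i. i < n \<Longrightarrow> c i \<in> centralizer a"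
proof -
  obtain n c where p: "p = (\<lambda>x. \<Sum>i<n. scale (x ^ i) (c i))"
    using assms(1) by (rule polysE)
  show thesis
    using that[OF p] commuting_coefficients[OF assms(2)[unfolded p]] by blast
qed

text \<open>
  Division by the monic linear polynomial \<open>s - B\<close>: the remainder is the value at \<open>B\<close> with the powers of
  \<open>B\<close> written on the same side as the divisor.
\<close>

lemma right_remainder:
  "\<exists>h\<in>polys. \<forall>x. (\<Sum>i<n. scale (x ^ i) (c i)) = (scale x 1 - B) * h x + (\<Sum>i<n. B ^ i * c i)"
proof (induction n)
  case (Suc n)
  have monomial: "\<exists>h\<in>polys. \<forall>x. scale (x ^ n) d = (scale x 1 - B) * h x + B ^ n * d" for n d
  proof (induction n)
    case (Suc n)
    then obtain h where h: "h \<in> polys" "\<And>x. scale (x ^ n) d = (scale x 1 - B) * h x + B ^ n * d"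
      by blast
    have "scale (x ^ Suc n) d = (scale x 1 - B) * ((\<lambda>x. scale x 1) * h + (\<lambda>_. B ^ n * d)) x + B ^ Suc n * d" for x
    proof -
      have "scale (x ^ Suc n) d = scale x (scale (x ^ n) d)"
        by simp
      also have "\<dots> = scale x ((scale x 1 - B) * h x) + scale x (B ^ n * d)"
        by (simp add: h(2) scale_right_distrib)
      also have "\<dots> = (scale x 1 - B) * ((\<lambda>x. scale x 1) * h + (\<lambda>_. B ^ n * d)) x + B ^ Suc n * d"
        by (simp add: algebra_simps scale_mult_left scale_mult_right)
      finally show ?thesis .
    qed
    then show ?case
      using h(1) by (intro bexI[of _ "(\<lambda>x. scale x 1) * h + (\<lambda>_. B ^ n * d)"]) auto
  qed (intro bexI[of _ 0], auto)
  obtain h where h: "h \<in> polys" "\<And>x. (\<Sum>i<n. scale (x ^ i) (c i)) = (scale x 1 - B) * h x + (\<Sum>i<n. B ^ i * c i)"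
    using Suc by blast
  obtain g where g: "g \<in> polys" "\<And>x. scale (x ^ n) (c n) = (scale x 1 - B) * g x + B ^ n * c n"
    using monomial by blast
  show ?case
    by (rule bexI[of _ "h + g"]) (use h g in \<open>auto simp: distrib_left\<close>)
qed (intro bexI[of _ 0], auto)

lemma left_remainder:
  "\<exists>h\<in>polys. \<forall>x. (\<Sum>i<n. scale (x ^ i) (c i)) = h x * (scale x 1 - B) + (\<Sum>i<n. c i * B ^ i)"
proof -
  obtain h where h: "h \<in> infinite_division_algebra.polys opp_scale"
    "\<forall>x. (\<Sum>i<n. opp_scale (x ^ i) (Op (c i))) = (opp_scale x 1 - Op B) * h x + (\<Sum>i<n. Op B ^ i * Op (c i))"
    using infinite_division_algebra.right_remainder[OF opposite_algebra, of "\<lambda>i. Op (c i)" n "Op B"]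
    by (elim bexE)
  have "(\<Sum>i<n. scale (x ^ i) (c i)) = unop (h x) * (scale x 1 - B) + (\<Sum>i<n. c i * B ^ i)" for x
  proof -
    have "Op (\<Sum>i<n. scale (x ^ i) (c i)) = Op (unop (h x) * (scale x 1 - B) + (\<Sum>i<n. c i * B ^ i))"
      using h(2)[rule_format, of x] by (simp only: opp.sel opp.collapse unop_1 Op_simps Op_sum Op_power)
    then show ?thesis
      by simp
  qed
  moreover have "(\<lambda>x. unop (h x)) \<in> polys"
    using h(1) by (simp flip: polys_opposite_iff)
  ultimately show ?thesis
    by (intro bexI[of _ "\<lambda>x. unop (h x)"] allI)
qed

text \<open>
  Multiplication by the central variable raises the degree of a nonzero polynomial by one.
  Applied to left or right multiplication by \<open>B\<close> in the role of \<open>h \<mapsto> \<phi>\<close>, this shows that no multiple of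
  \<open>s - B\<close> is a nonzero constant.
\<close>

lemma scalar_mult_not_degree_preserving:
  assumes "h \<in> polys" "\<And>n. h \<in> poly_below n \<Longrightarrow> \<phi> \<in> poly_below n"
    and "\<And>x. scale x (h x) = r + \<phi> x"
  shows "h = 0"
proof (rule ccontr)
  assume "h \<noteq> 0"
  obtain m where "h \<in> poly_below m"
    using assms(1) by (auto simp: polys_def)
  define n where "n = (LEAST n. h \<in> poly_below n)"
  have "h \<in> poly_below n"
    unfolding n_def by (rule LeastI) fact
  with \<open>h \<noteq> 0\<close> obtain i where n: "n = Suc i"
    by (cases n) auto
  obtain g c where g: "g \<in> poly_below i" "h = (\<lambda>x. g x + scale (x ^ i) c)"
    using \<open>h \<in> poly_below n\<close> unfolding n poly_below_Suc_iff_top by blast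
  have "(\<lambda>_. r) + \<phi> - (\<lambda>x. scale x (g x)) \<in> poly_below n"
    using assms(2)[OF \<open>h \<in> poly_below n\<close>] poly_below_scale[OF g(1)]
      poly_below_mono[OF _ const_in_poly_below[of r 0], of n]
    by (intro poly_below_diff poly_below_add) (simp_all add: n)
  also have "(\<lambda>_. r) + \<phi> - (\<lambda>x. scale x (g x)) = (\<lambda>x. scale (x ^ n) c)"
    using assms(3) by (simp add: g n fun_eq_iff scale_right_distrib flip: assms(3))
  finally obtain d where d: "(\<lambda>x. scale (x ^ n) c) = (\<lambda>x. \<Sum>i<n. scale (x ^ i) (d i))"
    unfolding poly_below_def by blast
  have "(\<Sum>i<Suc n. scale (x ^ i) ((d(n := - c)) i)) = 0" for x
    using fun_cong[OF d, of x] by simp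
  then have "{x. (\<Sum>i<Suc n. scale (x ^ i) ((d(n := - c)) i)) = 0} = UNIV"
    by simp
  then have "(d(n := - c)) n = 0"
    using poly_coeff_eq_0[of "d(n := - c)" "Suc n" n] infinite_field by (metis lessI)
  then have "h = g"
    by (simp add: g)
  then have "h \<in> poly_below i"
    using g(1) by simp
  then show False
    using not_less_Least[of i "\<lambda>n. h \<in> poly_below n"] n by (simp add: n_def)
qed

lemma linear_mult_eq_const:
  assumes "h \<in> polys" "\<And>x. (scale x 1 - B) * h x = r"
  shows "r = 0"
proof -
  have "h = 0"
  proof (rule scalar_mult_not_degree_preserving[OF assms(1)])
    show "(\<lambda>_. B) * h \<in> poly_below n" if "h \<in> poly_below n" for n
      using that by (rule poly_below_const_mult_left)
    show "scale x (h x) = r + ((\<lambda>_. B) * h) x" for x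
      by (simp add: scale_mult_left left_diff_distrib flip: assms(2)[of x])
  qed
  then show ?thesis
    using assms(2) by simp
qed

lemma mult_linear_eq_const:
  assumes "h \<in> polys" "\<And>x. h x * (scale x 1 - B) = r"
  shows "r = 0"
proof -
  have "h = 0"
  proof (rule scalar_mult_not_degree_preserving[OF assms(1)])
    show "h * (\<lambda>_. B) \<in> poly_below n" if "h \<in> poly_below n" for n
      using that by (rule poly_below_const_mult_right)
    show "scale x (h x) = r + (h * (\<lambda>_. B)) x" for x
      by (simp add: scale_mult_right right_diff_distrib flip: assms(2)[of x])
  qed
  then show ?thesis
    using assms(2) by simp
qed

end

context infinite_division_algebra
begin

lemma scalar_commute: "scale x 1 * d = d * scale x 1"
  by (simp add: scale_mult_left scale_mult_right)

lemma scalar_minus_const_MOST_nonzero: "\<forall>\<^sub>\<infinity>x. scale x 1 - B \<noteq> 0"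
proof -
  have "(\<lambda>x. scale x 1) - (\<lambda>_. B) \<noteq> 0"
  proof
    assume "(\<lambda>x. scale x 1) - (\<lambda>_. B) = 0"
    then have "scale x 1 = B" for x
      by (auto simp: fun_eq_iff)
    from this[of 0] this[of 1] show False
      by simp
  qed
  from poly_nonzero_MOST[OF _ this] show ?thesis
    by auto
qed

text \<open>
  The polynomials \<open>g\<close> for which both \<open>g f\<^sub>1\<close> and \<open>g f\<^sub>2\<close> are polynomial form a left ideal, and right
  multiplication by \<open>a\<close> preserves it because \<open>a\<close> commutes with \<open>f\<^sub>1\<close> and \<open>f\<^sub>2\<close>.
\<close>

lemma clear_denominators_commuting:
  assumes "rational f1" "rational f2"
    and "\<forall>\<^sub>\<infinity>x. f1 x * a = a * f1 x" "\<forall>\<^sub>\<infinity>x. f2 x * a = a * f2 x"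
  obtains g p1 p2 where "g \<in> polys" "g \<noteq> 0" "\<forall>x. g x * a = a * g x"
    "p1 \<in> polys" "\<forall>x. p1 x * a = a * p1 x" "\<forall>\<^sub>\<infinity>x. g x * f1 x = p1 x"
    "p2 \<in> polys" "\<forall>x. p2 x * a = a * p2 x" "\<forall>\<^sub>\<infinity>x. g x * f2 x = p2 x"
proof -
  define J where "J = {g \<in> polys. \<exists>p1\<in>polys. \<exists>p2\<in>polys. \<forall>\<^sub>\<infinity>x. g x * f1 x = p1 x \<and> g x * f2 x = p2 x}"
  have JI: "g \<in> J" if "g \<in> polys" "p1 \<in> polys" "p2 \<in> polys"
    "\<forall>\<^sub>\<infinity>x. g x * f1 x = p1 x \<and> g x * f2 x = p2 x" for g p1 p2
    unfolding J_def using that by blast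
  have JE: "\<exists>p1\<in>polys. \<exists>p2\<in>polys. \<forall>\<^sub>\<infinity>x. g x * f1 x = p1 x \<and> g x * f2 x = p2 x" "g \<in> polys" if "g \<in> J" for g
    using that unfolding J_def by blast+
  have "rational (if i then f1 else f2)" for i
    using assms by simp
  then obtain q where q: "q \<in> polys" "q \<noteq> 0" "\<forall>i\<in>UNIV. \<exists>p\<in>polys. \<forall>\<^sub>\<infinity>x. q x * (if i then f1 else f2) x = p x"
    using rational_common_left_denominator[of "UNIV :: bool set" "\<lambda>i. if i then f1 else f2"] by auto
  have "\<exists>g\<in>J. g \<noteq> 0 \<and> (\<forall>x. g x * a = a * g x)"
  proof (rule left_ideal_commuting_element)
    show "J \<subseteq> polys"
      by (auto simp: J_def)
    obtain p1 where p1: "p1 \<in> polys" "\<forall>\<^sub>\<infinity>x. q x * f1 x = p1 x"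
      using bspec[OF q(3), of True] by auto
    obtain p2 where p2: "p2 \<in> polys" "\<forall>\<^sub>\<infinity>x. q x * f2 x = p2 x"
      using bspec[OF q(3), of False] by auto
    show "q \<in> J"
      by (rule JI[OF q(1) p1(1) p2(1)]) (use p1(2) p2(2) in eventually_elim, simp)
    show "q \<noteq> 0"
      by fact
  next
    fix g h assume "g \<in> J" "h \<in> J"
    then obtain p1 p2 q1 q2 where *: "p1 \<in> polys" "p2 \<in> polys" "q1 \<in> polys" "q2 \<in> polys"
      "\<forall>\<^sub>\<infinity>x. g x * f1 x = p1 x \<and> g x * f2 x = p2 x" "\<forall>\<^sub>\<infinity>x. h x * f1 x = q1 x \<and> h x * f2 x = q2 x"
      using JE(1)[of g] JE(1)[of h] by auto
    show "g - h \<in> J"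
    proof (rule JI)
      show "\<forall>\<^sub>\<infinity>x. (g - h) x * f1 x = (p1 - q1) x \<and> (g - h) x * f2 x = (p2 - q2) x"
        using *(5,6) by eventually_elim (simp add: left_diff_distrib)
    qed (intro polys_diff * JE(2) \<open>g \<in> J\<close> \<open>h \<in> J\<close>)+
  next
    fix g d assume "g \<in> J"
    then obtain p1 p2 where *: "p1 \<in> polys" "p2 \<in> polys"
      "\<forall>\<^sub>\<infinity>x. g x * f1 x = p1 x \<and> g x * f2 x = p2 x"
      using JE(1)[of g] by auto
    show "(\<lambda>_. d) * g \<in> J"
    proof (rule JI)
      show "\<forall>\<^sub>\<infinity>x. ((\<lambda>_. d) * g) x * f1 x = ((\<lambda>_. d) * p1) x \<and> ((\<lambda>_. d) * g) x * f2 x = ((\<lambda>_. d) * p2) x"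
        using *(3) by eventually_elim (simp add: mult.assoc)
    qed (intro polys_mult polys_const * JE(2) \<open>g \<in> J\<close>)+
  next
    fix g assume "g \<in> J"
    then obtain p1 p2 where *: "p1 \<in> polys" "p2 \<in> polys"
      "\<forall>\<^sub>\<infinity>x. g x * f1 x = p1 x \<and> g x * f2 x = p2 x"
      using JE(1)[of g] by auto
    show "g * (\<lambda>_. a) \<in> J"
    proof (rule JI)
      show "\<forall>\<^sub>\<infinity>x. (g * (\<lambda>_. a)) x * f1 x = (p1 * (\<lambda>_. a)) x \<and> (g * (\<lambda>_. a)) x * f2 x = (p2 * (\<lambda>_. a)) x"
        using *(3) assms(3,4)
      proof eventually_elim
        case (elim x)
        have "g x * a * f1 x = g x * f1 x * a" "g x * a * f2 x = g x * f2 x * a"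
          by (simp_all only: mult.assoc elim(2,3))
        then show ?case
          using elim(1) by simp
      qed
    qed (intro polys_mult polys_const * JE(2) \<open>g \<in> J\<close>)+
  qed
  then obtain g where g: "g \<in> J" "g \<noteq> 0" "\<forall>x. g x * a = a * g x"
    by blast
  then obtain p1 p2 where p: "p1 \<in> polys" "p2 \<in> polys"
      "\<forall>\<^sub>\<infinity>x. g x * f1 x = p1 x \<and> g x * f2 x = p2 x"
    using JE(1)[of g] by auto
  have commute: "p * (\<lambda>_. a) = (\<lambda>_. a) * p"
    if "p \<in> polys" "\<forall>\<^sub>\<infinity>x. g x * f x = p x" "\<forall>\<^sub>\<infinity>x. f x * a = a * f x" for f p
  proof (rule poly_eq_if_MOST_eq)
    show "\<forall>\<^sub>\<infinity>x. (p * (\<lambda>_. a)) x = ((\<lambda>_. a) * p) x"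
      using that(2,3)
    proof eventually_elim
      case (elim x)
      have "g x * f x * a = a * (g x * f x)"
        using elim(2) g(3) by (metis mult.assoc)
      then show ?case
        using elim(1) by simp
    qed
  qed (use that in auto)
  have "\<forall>\<^sub>\<infinity>x. g x * f1 x = p1 x" "\<forall>\<^sub>\<infinity>x. g x * f2 x = p2 x"
    using p(3) by (auto elim: eventually_mono)
  then show thesis
    using that[of g p1 p2] g JE(2)[of g] p commute[of p1 f1] commute[of p2 f2] assms(3,4)
    by (auto simp: fun_eq_iff)
qed

text \<open>
  After clearing denominators, \<open>[a, U] = F z\<close> with \<open>F = p\<^sub>1 + p\<^sub>2 b\<close> and \<open>p\<^sub>1, p\<^sub>2 \<in> E[s]\<close>. Let \<open>R\<close> and \<open>L\<close>
  consist of the right and left denominators of \<open>U\<close>. For \<open>p \<in> L\<close> and \<open>q \<in> R\<close>,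
  \<open>p F z q = p a (U q) - (p U) a q\<close> is a polynomial. If every \<open>q \<in> R\<close> is divisible by \<open>s - b^2\<close> on the
  left, then \<open>F z q\<close> is always polynomial, which makes \<open>R\<close> stable under left multiplication by \<open>a\<close>.
  Otherwise some \<open>q \<in> R\<close> has a nonzero remainder \<open>r \<in> D\<close>, and since \<open>r\<close> is invertible, \<open>p F z\<close> is
  polynomial for every \<open>p \<in> L\<close>, which makes \<open>L\<close> stable under right multiplication by \<open>a\<close>.
\<close>

lemma resolvent_terms_vanish_if_commutator:
  fixes a b :: 'd
  defines "z \<equiv> \<lambda>x. inverse (scale x 1 - b ^ 2)"
  assumes nl: "\<not> left_algebraic_elt (centralizer a) b" and nr: "\<not> right_algebraic_elt (centralizer a) b"
    and "rational u" "rational f1" "rational f2"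
    and "\<forall>\<^sub>\<infinity>x. f1 x * a = a * f1 x" "\<forall>\<^sub>\<infinity>x. f2 x * a = a * f2 x"
    and u: "\<forall>\<^sub>\<infinity>x. a * u x - u x * a = f1 x * z x + f2 x * (b * z x)"
  shows "(\<forall>\<^sub>\<infinity>x. f1 x = 0) \<and> (\<forall>\<^sub>\<infinity>x. f2 x = 0)"
proof -
  define s where "s x = scale x 1 - b ^ 2" for x
  have s: "s \<in> polys"
    using polys_diff[OF polys_scalar polys_const[of "b ^ 2"]] by (simp add: s_def[abs_def] fun_diff_def)
  have s_nz: "\<forall>\<^sub>\<infinity>x. s x \<noteq> 0"
    unfolding s_def by (rule scalar_minus_const_MOST_nonzero)
  have z: "z = (\<lambda>x. inverse (s x))"
    by (simp add: z_def s_def)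
  obtain g p1 p2 where g: "g \<in> polys" "g \<noteq> 0" "\<forall>x. g x * a = a * g x"
    and p1: "p1 \<in> polys" "\<forall>x. p1 x * a = a * p1 x" "\<forall>\<^sub>\<infinity>x. g x * f1 x = p1 x"
    and p2: "p2 \<in> polys" "\<forall>x. p2 x * a = a * p2 x" "\<forall>\<^sub>\<infinity>x. g x * f2 x = p2 x"
    using clear_denominators_commuting[of f1 f2 a] assms by blast
  define F where "F = p1 + p2 * (\<lambda>_. b)"
  have F: "F \<in> polys"
    using p1 p2 by (auto simp: F_def)
  have "rational (g * u)"
    using g assms by auto
  moreover define U where "U = g * u"
  ultimately have U: "rational U"
    by simp
  have TU: "\<forall>\<^sub>\<infinity>x. a * U x - U x * a = F x * z x"
    using u p1(3) p2(3)
  proof eventually_elim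
    case (elim x)
    have "a * U x - U x * a = g x * (a * u x - u x * a)"
      using g(3) by (simp add: U_def right_diff_distrib flip: mult.assoc)
    also have "\<dots> = g x * f1 x * z x + g x * f2 x * b * z x"
      by (simp add: elim(1) distrib_left mult.assoc)
    finally show ?case
      by (simp add: F_def distrib_right elim)
  qed

  \<comment> \<open>A nonzero \<open>p \<in> E[s]\<close> for which \<open>p F z\<close> has no pole would make \<open>b\<close> left algebraic, unless \<open>p F = 0\<close>.\<close>
  have no_left: "p1 = 0 \<and> p2 = 0"
    if p: "p \<in> polys" "p \<noteq> 0" "\<forall>x. p x * a = a * p x" "h \<in> polys" "\<forall>\<^sub>\<infinity>x. p x * F x * z x = h x" for p h
  proof -
    have comm: "\<forall>x. (p * p1) x * a = a * (p * p1) x" "\<forall>x. (p * p2) x * a = a * (p * p2) x"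
      using p(3) p1(2) p2(2) by (metis times_fun_apply mult.assoc)+
    obtain c1 n1 where c1: "p * p1 = (\<lambda>x. \<Sum>i<n1. scale (x ^ i) (c1 i))" "\<And>i. i < n1 \<Longrightarrow> c1 i \<in> centralizer a"
      using commuting_poly_coefficients[OF polys_mult[OF p(1) p1(1)] comm(1)] by blast
    obtain c2 n2 where c2: "p * p2 = (\<lambda>x. \<Sum>i<n2. scale (x ^ i) (c2 i))" "\<And>i. i < n2 \<Longrightarrow> c2 i \<in> centralizer a"
      using commuting_poly_coefficients[OF polys_mult[OF p(1) p2(1)] comm(2)] by blast
    define n where "n = max n1 n2"
    define d1 where "d1 i = (if i < n1 then c1 i else 0)" for i
    define d2 where "d2 i = (if i < n2 then c2 i else 0)" for i
    have d: "d1 i \<in> centralizer a" "d2 i \<in> centralizer a" for i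
      by (simp_all add: d1_def d2_def c1 c2)
    have pad: "(\<Sum>i<m. scale (x ^ i) (c i)) = (\<Sum>i<n. scale (x ^ i) (if i < m then c i else 0))"
      if "m \<le> n" for m x and c :: "nat \<Rightarrow> 'd"
      using that by (intro sum.mono_neutral_cong_left) auto
    have e1: "p x * p1 x = (\<Sum>i<n. scale (x ^ i) (d1 i))" for x
      using fun_cong[OF c1(1), of x] pad[of n1 x c1] by (simp add: d1_def n_def)
    have e2: "p x * p2 x = (\<Sum>i<n. scale (x ^ i) (d2 i))" for x
      using fun_cong[OF c2(1), of x] pad[of n2 x c2] by (simp add: d2_def n_def)
    have pF: "p x * F x = (\<Sum>i<n. scale (x ^ i) (d1 i + d2 i * b))" for x
    proof -
      have "p x * F x = p x * p1 x + p x * p2 x * b"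
        by (simp add: F_def distrib_left mult.assoc)
      then show ?thesis
        by (simp add: e1 e2 sum_distrib_right scale_mult_left scale_right_distrib sum.distrib)
    qed
    obtain k where k: "k \<in> polys"
      "\<And>x. p x * F x = k x * s x + (\<Sum>i<n. (d1 i + d2 i * b) * (b ^ 2) ^ i)"
      using left_remainder[of "\<lambda>i. d1 i + d2 i * b" n "b ^ 2"] unfolding pF s_def by blast
    have "p * F = h * s"
    proof (rule poly_eq_if_MOST_eq)
      show "\<forall>\<^sub>\<infinity>x. (p * F) x = (h * s) x"
        using that(5) s_nz
      proof eventually_elim
        case (elim x)
        have "(p * F) x = p x * F x * z x * s x"
          using elim(2) by (simp add: z mult.assoc)
        also have "\<dots> = h x * s x"
          by (simp only: elim(1))
        finally show ?case
          by simp
      qed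
    qed (use p F s in auto)
    then have "(h - k) x * s x = (\<Sum>i<n. (d1 i + d2 i * b) * (b ^ 2) ^ i)" for x
      using k(2)[of x] by (auto simp: fun_eq_iff left_diff_distrib)
    then have "(\<Sum>i<n. (d1 i + d2 i * b) * (b ^ 2) ^ i) = 0"
      using mult_linear_eq_const[of "h - k" "b ^ 2"] k(1) p(4) unfolding s_def by blast
    then have "d1 i = 0 \<and> d2 i = 0" if "i < n" for i
      using not_left_algebraic_square[OF nl, of n d1 d2 i] d that by blast
    then have "p * p1 = 0" "p * p2 = 0"
      by (auto simp: fun_eq_iff e1 e2)
    then show ?thesis
      using polys_no_zero_divisors p(1,2) p1(1) p2(1) by blast
  qed

  \<comment> \<open>A nonzero \<open>q \<in> E[s]\<close> divisible by \<open>s - b^2\<close> would make \<open>b\<close> right algebraic.\<close>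
  have no_right: "q = 0"
    if q: "q \<in> polys" "\<forall>x. q x * a = a * q x" "h \<in> polys" "\<forall>x. q x = s x * h x" for q h
  proof -
    obtain c n where c: "q = (\<lambda>x. \<Sum>i<n. scale (x ^ i) (c i))" "\<And>i. i < n \<Longrightarrow> c i \<in> centralizer a"
      using commuting_poly_coefficients[OF q(1,2)] by blast
    obtain k where k: "k \<in> polys" "\<And>x. q x = s x * k x + (\<Sum>i<n. (b ^ 2) ^ i * c i)"
      using right_remainder[of c n "b ^ 2"] unfolding c(1) s_def by blast
    have "s x * (h - k) x = (\<Sum>i<n. (b ^ 2) ^ i * c i)" for x
      using k(2)[of x] q(4) by (simp add: right_diff_distrib)
    then have "(\<Sum>i<n. (b ^ 2) ^ i * c i) = 0"
      using linear_mult_eq_const[of "h - k" "b ^ 2"] k(1) q(3) unfolding s_def by blast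
    then have "c i = 0" if "i < n" for i
      using not_right_algebraic_square[OF nr _ c(2)] that by auto
    then show ?thesis
      by (simp add: c(1) fun_eq_iff)
  qed

  define R where "R = {q \<in> polys. \<exists>p\<in>polys. \<forall>\<^sub>\<infinity>x. U x * q x = p x}"
  define L where "L = {q \<in> polys. \<exists>p\<in>polys. \<forall>\<^sub>\<infinity>x. q x * U x = p x}"
  obtain pR qR where R: "pR \<in> polys" "qR \<in> polys" "qR \<noteq> 0" "\<forall>\<^sub>\<infinity>x. U x * qR x = pR x"
    using U by (rule rationalE)
  obtain pL qL where L: "pL \<in> polys" "qL \<in> polys" "qL \<noteq> 0" "\<forall>\<^sub>\<infinity>x. qL x * U x = pL x"
    using U by (rule rational_left_denominator)

  have "p1 = 0 \<and> p2 = 0"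
  proof (cases "\<forall>q\<in>R. \<exists>h\<in>polys. \<forall>x. q x = s x * h x")
    case True
    have "\<exists>q\<in>R. q \<noteq> 0 \<and> (\<forall>x. q x * a = a * q x)"
    proof (rule right_ideal_commuting_element)
      show "R \<subseteq> polys" "qR \<in> R" "qR \<noteq> 0"
        using R by (auto simp: R_def)
    next
      fix q q' assume "q \<in> R" "q' \<in> R"
      then obtain p p' where *: "p \<in> polys" "p' \<in> polys" "\<forall>\<^sub>\<infinity>x. U x * q x = p x" "\<forall>\<^sub>\<infinity>x. U x * q' x = p' x"
        by (auto simp: R_def)
      have "\<forall>\<^sub>\<infinity>x. U x * (q - q') x = (p - p') x"
        using *(3,4) by eventually_elim (simp add: right_diff_distrib)
      then show "q - q' \<in> R"
        using * \<open>q \<in> R\<close> \<open>q' \<in> R\<close> unfolding R_def by blast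
    next
      fix q d assume "q \<in> R"
      then obtain p where *: "p \<in> polys" "\<forall>\<^sub>\<infinity>x. U x * q x = p x"
        by (auto simp: R_def)
      have "\<forall>\<^sub>\<infinity>x. U x * (q * (\<lambda>_. d)) x = (p * (\<lambda>_. d)) x"
        using *(2) by eventually_elim (simp flip: mult.assoc)
      then show "q * (\<lambda>_. d) \<in> R"
        using * \<open>q \<in> R\<close> unfolding R_def by blast
    next
      fix q assume "q \<in> R"
      then obtain p where *: "p \<in> polys" "\<forall>\<^sub>\<infinity>x. U x * q x = p x"
        by (auto simp: R_def)
      obtain h where h: "h \<in> polys" "\<And>x. q x = s x * h x"
        using True \<open>q \<in> R\<close> by blast
      have "\<forall>\<^sub>\<infinity>x. U x * ((\<lambda>_. a) * q) x = ((\<lambda>_. a) * p - F * h) x"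
        using *(2) TU s_nz
      proof eventually_elim
        case (elim x)
        have "U x * (a * q x) = a * (U x * q x) - (a * U x - U x * a) * q x"
          by (simp add: left_diff_distrib mult.assoc)
        also have "(a * U x - U x * a) * q x = F x * (z x * s x) * h x"
          by (simp only: elim(2) h(2) mult.assoc)
        finally show ?case
          using elim by (simp add: z)
      qed
      then show "(\<lambda>_. a) * q \<in> R"
        using * h F \<open>q \<in> R\<close> unfolding R_def by blast
    qed
    then show ?thesis
      using True no_right unfolding R_def by blast
  next
    case False
    then obtain q where q: "q \<in> R" "\<not> (\<exists>h\<in>polys. \<forall>x. q x = s x * h x)"
      by blast
    then obtain pq where pq: "q \<in> polys" "pq \<in> polys" "\<forall>\<^sub>\<infinity>x. U x * q x = pq x"
      by (auto simp: R_def)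
    obtain h r where h: "h \<in> polys" "\<And>x. q x = s x * h x + r"
    proof -
      obtain n c where "q = (\<lambda>x. \<Sum>i<n. scale (x ^ i) (c i))"
        using pq(1) by (rule polysE)
      then show thesis
        using that right_remainder[of c n "b ^ 2"] unfolding s_def by auto
    qed
    have "r \<noteq> 0"
      using q(2) h by auto
    have pole: "\<exists>k\<in>polys. \<forall>\<^sub>\<infinity>x. p x * F x * z x = k x"
      if p: "p \<in> polys" "p' \<in> polys" "\<forall>\<^sub>\<infinity>x. p x * U x = p' x" for p p'
    proof
      show "(p * (\<lambda>_. a) * pq - p' * (\<lambda>_. a) * q - p * F * h) * (\<lambda>_. inverse r) \<in> polys"
        using p(1,2) pq(1,2) F h(1) by (intro polys_mult polys_diff polys_const)
      show "\<forall>\<^sub>\<infinity>x. p x * F x * z x = ((p * (\<lambda>_. a) * pq - p' * (\<lambda>_. a) * q - p * F * h) * (\<lambda>_. inverse r)) x"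
        using p(3) pq(3) TU s_nz
      proof eventually_elim
        case (elim x)
        have "p x * F x * z x * r = p x * (F x * z x) * q x - p x * F x * (z x * s x) * h x"
          by (simp add: h(2) distrib_left mult.assoc)
        also have "p x * (F x * z x) * q x = p x * a * (U x * q x) - p x * U x * a * q x"
          by (simp add: left_diff_distrib right_diff_distrib mult.assoc flip: elim(3))
        finally have "p x * F x * z x * r = p x * a * pq x - p' x * a * q x - p x * F x * h x"
          using elim by (simp add: z)
        then have "p x * F x * z x * r * inverse r = (p x * a * pq x - p' x * a * q x - p x * F x * h x) * inverse r"
          by simp
        then show ?case
          using \<open>r \<noteq> 0\<close> by (simp add: mult.assoc)
      qed
    qed
    have "\<exists>p\<in>L. p \<noteq> 0 \<and> (\<forall>x. p x * a = a * p x)"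
    proof (rule left_ideal_commuting_element)
      show "L \<subseteq> polys" "qL \<in> L" "qL \<noteq> 0"
        using L by (auto simp: L_def)
    next
      fix q q' assume "q \<in> L" "q' \<in> L"
      then obtain p p' where *: "p \<in> polys" "p' \<in> polys" "\<forall>\<^sub>\<infinity>x. q x * U x = p x" "\<forall>\<^sub>\<infinity>x. q' x * U x = p' x"
        by (auto simp: L_def)
      have "\<forall>\<^sub>\<infinity>x. (q - q') x * U x = (p - p') x"
        using *(3,4) by eventually_elim (simp add: left_diff_distrib)
      then show "q - q' \<in> L"
        using * \<open>q \<in> L\<close> \<open>q' \<in> L\<close> unfolding L_def by blast
    next
      fix q d assume "q \<in> L"
      then obtain p where *: "p \<in> polys" "\<forall>\<^sub>\<infinity>x. q x * U x = p x"
        by (auto simp: L_def)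
      have "\<forall>\<^sub>\<infinity>x. ((\<lambda>_. d) * q) x * U x = ((\<lambda>_. d) * p) x"
        using *(2) by eventually_elim (simp add: mult.assoc)
      then show "(\<lambda>_. d) * q \<in> L"
        using * \<open>q \<in> L\<close> unfolding L_def by blast
    next
      fix q assume "q \<in> L"
      then obtain p where *: "q \<in> polys" "p \<in> polys" "\<forall>\<^sub>\<infinity>x. q x * U x = p x"
        by (auto simp: L_def)
      obtain k where k: "k \<in> polys" "\<forall>\<^sub>\<infinity>x. q x * F x * z x = k x"
        using pole[OF *] by blast
      have "\<forall>\<^sub>\<infinity>x. (q * (\<lambda>_. a)) x * U x = (k + p * (\<lambda>_. a)) x"
        using *(3) TU k(2)
      proof eventually_elim
        case (elim x)
        have "q x * a * U x = q x * (a * U x - U x * a) + q x * U x * a"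
          by (simp add: right_diff_distrib mult.assoc)
        then show ?case
          using elim by (simp flip: mult.assoc)
      qed
      then show "q * (\<lambda>_. a) \<in> L"
        using * k(1) unfolding L_def by blast
    qed
    then obtain p p' where p: "p \<in> polys" "p \<noteq> 0" "\<forall>x. p x * a = a * p x" "p' \<in> polys" "\<forall>\<^sub>\<infinity>x. p x * U x = p' x"
      by (auto simp: L_def)
    then obtain k where "k \<in> polys" "\<forall>\<^sub>\<infinity>x. p x * F x * z x = k x"
      using pole by blast
    then show ?thesis
      using no_left p by blast
  qed
  moreover have "\<forall>\<^sub>\<infinity>x. f1 x = 0" if "p1 = 0"
    using p1(3) poly_nonzero_MOST[OF g(1,2)] by eventually_elim (auto simp: that)
  moreover have "\<forall>\<^sub>\<infinity>x. f2 x = 0" if "p2 = 0"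
    using p2(3) poly_nonzero_MOST[OF g(1,2)] by eventually_elim (auto simp: that)
  ultimately show ?thesis
    by blast
qed

end

context infinite_division_algebra
begin

section \<open>Elements algebraic on neither side\<close>

text \<open>
  Gaussian elimination over the division ring of rational functions: \<open>v j\<close> is the \<open>j\<close>-th row, \<open>i\<close>
  indexes the columns, and \<open>i0\<close> is a pivot of the last row. Only the finitely many zeros of the
  pivot are lost on passing to the reduced rows \<open>w j\<close>.
\<close>

lemma rational_dependence_if_infinite_dependences:
  fixes v :: "nat \<Rightarrow> 'i \<Rightarrow> 'k \<Rightarrow> 'd"
  assumes "\<And>j i. j < N \<Longrightarrow> rational (v j i)"
    and "infinite {x. \<exists>c. (\<exists>j<N. c j \<noteq> 0) \<and> (\<forall>i. (\<Sum>j<N. c j * v j i x) = 0)}"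
  shows "\<exists>d. (\<forall>j<N. rational (d j)) \<and> (\<exists>j<N. \<not> (\<forall>\<^sub>\<infinity>x. d j x = 0)) \<and>
    (\<forall>i. \<forall>\<^sub>\<infinity>x. (\<Sum>j<N. d j x * v j i x) = 0)"
  using assms
proof (induction N arbitrary: v)
  case 0
  then show ?case by simp
next
  case (Suc N)
  show ?case
  proof (cases "\<forall>i. \<forall>\<^sub>\<infinity>x. v N i x = 0")
    case True
    define d where "d j = (if j = N then 1 else 0 :: 'k \<Rightarrow> 'd)" for j
    have "(\<Sum>j<Suc N. d j x * v j i x) = v N i x" for i x
      by (simp add: d_def)
    moreover have "\<not> (\<forall>\<^sub>\<infinity>x. d N x = 0)"
      using infinite_field by (simp add: d_def eventually_cofinite)
    moreover have "rational (d j)" for j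
      by (auto simp: d_def)
    ultimately show ?thesis
      using True by (intro exI[of _ d]) (simp add: exI[of _ N] del: sum.lessThan_Suc)
  next
    case False
    then obtain i0 where "\<not> (\<forall>\<^sub>\<infinity>x. v N i0 x = 0)"
      by blast
    with rational_zero_or_nonzero[of "v N i0"] Suc.prems(1) have i0: "\<forall>\<^sub>\<infinity>x. v N i0 x \<noteq> 0"
      by auto
    define \<rho> where "\<rho> x = inverse (v N i0 x)" for x
    have \<rho>: "rational \<rho>"
      unfolding \<rho>_def using Suc.prems(1) by (intro rational_inverse) auto
    define w where "w j i = v j i - v j i0 * \<rho> * v N i" for j i
    have sum_w: "(\<Sum>j<N. c j * w j i x) = (\<Sum>j<N. c j * v j i x) - (\<Sum>j<N. c j * v j i0 x) * \<rho> x * v N i x"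
      for c i x
      by (simp add: w_def right_diff_distrib sum_subtractf sum_distrib_right mult.assoc)
    have sub: "{x. \<exists>c. (\<exists>j<Suc N. c j \<noteq> 0) \<and> (\<forall>i. (\<Sum>j<Suc N. c j * v j i x) = 0)} \<subseteq>
        {x. v N i0 x = 0} \<union> {x. \<exists>c. (\<exists>j<N. c j \<noteq> 0) \<and> (\<forall>i. (\<Sum>j<N. c j * w j i x) = 0)}"
    proof (intro subsetI, unfold Un_iff mem_Collect_eq, intro disjCI)
      fix x
      assume "\<exists>c. (\<exists>j<Suc N. c j \<noteq> 0) \<and> (\<forall>i. (\<Sum>j<Suc N. c j * v j i x) = 0)"
        and nw: "\<not> (\<exists>c. (\<exists>j<N. c j \<noteq> 0) \<and> (\<forall>i. (\<Sum>j<N. c j * w j i x) = 0))"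
      then obtain c where c: "\<exists>j<Suc N. c j \<noteq> 0" "\<And>i. (\<Sum>j<N. c j * v j i x) = - (c N * v N i x)"
        by (auto simp: eq_neg_iff_add_eq_0)
      show "v N i0 x = 0"
      proof (rule ccontr)
        assume nz: "v N i0 x \<noteq> 0"
        have "(\<Sum>j<N. c j * w j i x) = 0" for i
          unfolding sum_w c(2) using nz by (simp add: \<rho>_def mult.assoc)
        with nw have "c j = 0" if "j < N" for j
          using that by blast
        with c(2)[of i0] nz have "c N = 0"
          by simp
        with \<open>\<And>j. j < N \<Longrightarrow> c j = 0\<close> c(1) show False
          by (auto simp: less_Suc_eq)
      qed
    qed
    have "finite {x. v N i0 x = 0}"
      using i0 by (simp add: eventually_cofinite)
    with sub Suc.prems(2) have "infinite {x. \<exists>c. (\<exists>j<N. c j \<noteq> 0) \<and> (\<forall>i. (\<Sum>j<N. c j * w j i x) = 0)}"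
      using finite_subset by blast
    moreover have "rational (w j i)" if "j < N" for i j
      unfolding w_def using that Suc.prems(1) \<rho> by (intro rational_diff rational_mult) auto
    ultimately obtain d where d: "\<forall>j<N. rational (d j)" "\<exists>j<N. \<not> (\<forall>\<^sub>\<infinity>x. d j x = 0)"
      "\<And>i. \<forall>\<^sub>\<infinity>x. (\<Sum>j<N. d j x * w j i x) = 0"
      using Suc.IH[of w] by blast
    define d' where "d' = d(N := - ((\<Sum>j<N. d j * v j i0) * \<rho>))"
    have "rational (\<Sum>j<N. d j * v j i0)"
      using d(1) Suc.prems(1) by (intro rational_sum) auto
    then have "rational (0 - (\<Sum>j<N. d j * v j i0) * \<rho>)"
      using \<rho> by blast
    then have "\<forall>j<Suc N. rational (d' j)"
      using d(1) by (simp add: d'_def less_Suc_eq)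
    moreover have "\<exists>j<Suc N. \<not> (\<forall>\<^sub>\<infinity>x. d' j x = 0)"
    proof -
      obtain j where "j < N" "\<not> (\<forall>\<^sub>\<infinity>x. d j x = 0)"
        using d(2) by blast
      then show ?thesis
        by (intro exI[of _ j]) (simp add: d'_def)
    qed
    moreover have "\<forall>\<^sub>\<infinity>x. (\<Sum>j<Suc N. d' j x * v j i x) = 0" for i
      using d(3)[of i]
    proof eventually_elim
      case (elim x)
      have "(\<Sum>j<N. d j * v j i0) x = (\<Sum>j<N. d j x * v j i0 x)"
        by (induction N) simp_all
      then show ?case
        using elim unfolding sum_w by (simp add: d'_def)
    qed
    ultimately show ?thesis
      by (intro exI[of _ d'] conjI) (assumption, assumption, rule allI)
  qed
qed

text \<open>
  The sequences \<open>d\<close> that satisfy all the equations are stable under left multiplication, and replacing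
  \<open>d j\<close> by \<open>d j * a\<close> turns the \<open>i\<close>-th equation into the next one. Encoded as polynomials
  \<open>\<Sum> d\<^sub>j s^j\<close> they form a set to which \<open>left_ideal_commuting_element\<close> applies; the equation for \<open>i = 0\<close>
  of the resulting sequence is the algebraicity of \<open>b\<close>.
\<close>

lemma left_algebraic_if_twisted_dependence:
  fixes a b :: 'd
  assumes "\<exists>j<N. d j \<noteq> 0" "\<And>i. (\<Sum>j<N. d j * (a ^ i * b ^ j)) = 0"
  shows "left_algebraic_elt (centralizer a) b"
proof -
  define P where "P d = (\<lambda>x. \<Sum>j<N. scale (x ^ j) (d j :: 'd))" for d
  define J where "J = {P d | d. \<forall>i. (\<Sum>j<N. d j * (a ^ i * b ^ j)) = 0}"
  have JI: "P d \<in> J" if "\<And>i. (\<Sum>j<N. d j * (a ^ i * b ^ j)) = 0" for d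
    using that by (auto simp: J_def)
  have "\<exists>p\<in>J. p \<noteq> 0 \<and> (\<forall>x. p x * a = a * p x)"
  proof (rule left_ideal_commuting_element)
    show "J \<subseteq> polys"
      by (auto simp: J_def P_def polys_def intro: poly_belowI)
    show "P d \<in> J"
      by (rule JI) (rule assms)
    show "P d \<noteq> 0"
    proof
      assume "P d = 0"
      then have "{x. (\<Sum>j<N. scale (x ^ j) (d j)) = 0} = UNIV"
        by (simp add: P_def fun_eq_iff)
      then have "d j = 0" if "j < N" for j
        using poly_coeff_eq_0[of d N j] infinite_field that by simp
      then show False
        using assms(1) by blast
    qed
  next
    fix p q assume "p \<in> J" "q \<in> J"
    then obtain d e where *: "p = P d" "q = P e" "\<And>i. (\<Sum>j<N. d j * (a ^ i * b ^ j)) = 0"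
      "\<And>i. (\<Sum>j<N. e j * (a ^ i * b ^ j)) = 0"
      by (auto simp: J_def)
    have "p - q = P (\<lambda>j. d j - e j)"
      by (simp add: * P_def fun_eq_iff scale_right_diff_distrib sum_subtractf)
    then show "p - q \<in> J"
      by (simp only: ) (rule JI, simp add: left_diff_distrib sum_subtractf *)
  next
    fix p c assume "p \<in> J"
    then obtain d where *: "p = P d" "\<And>i. (\<Sum>j<N. d j * (a ^ i * b ^ j)) = 0"
      by (auto simp: J_def)
    have "(\<lambda>_. c) * p = P (\<lambda>j. c * d j)"
      by (simp add: * P_def fun_eq_iff sum_distrib_left scale_mult_right)
    moreover have "(\<Sum>j<N. c * d j * (a ^ i * b ^ j)) = 0" for i
      using *(2)[of i] by (simp add: mult.assoc flip: sum_distrib_left)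
    ultimately show "(\<lambda>_. c) * p \<in> J"
      using JI by simp
  next
    fix p assume "p \<in> J"
    then obtain d where *: "p = P d" "\<And>i. (\<Sum>j<N. d j * (a ^ i * b ^ j)) = 0"
      by (auto simp: J_def)
    have "p * (\<lambda>_. a) = P (\<lambda>j. d j * a)"
      by (simp add: * P_def fun_eq_iff sum_distrib_right scale_mult_left)
    moreover have "(\<Sum>j<N. d j * a * (a ^ i * b ^ j)) = 0" for i
      using *(2)[of "Suc i"] by (simp add: mult.assoc)
    ultimately show "p * (\<lambda>_. a) \<in> J"
      using JI by simp
  qed
  then obtain d where d: "P d \<noteq> 0" "\<forall>x. P d x * a = a * P d x" "\<And>i. (\<Sum>j<N. d j * (a ^ i * b ^ j)) = 0"
    by (auto simp: J_def)
  have "\<exists>j<N. d j \<noteq> 0"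
    using d(1) by (auto simp: P_def fun_eq_iff intro: sum.neutral)
  moreover have "d j \<in> centralizer a" if "j < N" for j
    using commuting_coefficients[OF d(2)[unfolded P_def] that] .
  moreover have "(\<Sum>j<N. d j * b ^ j) = 0"
    using d(3)[of 0] by simp
  ultimately show ?thesis
    using left_algebraic_eltI by blast
qed

lemma polys_power [intro]: "f \<in> polys \<Longrightarrow> (\<lambda>x. f x ^ n) \<in> polys"
proof (induction n)
  case (Suc n)
  then have "f * (\<lambda>x. f x ^ n) \<in> polys"
    by auto
  then show ?case
    by (simp add: times_fun_def)
qed auto

lemma polys_sum: "(\<And>i. i \<in> A \<Longrightarrow> f i \<in> polys) \<Longrightarrow> (\<Sum>i\<in>A. f i) \<in> polys"
  by (induction A rule: infinite_finite_induct) auto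

lemma fun_sum_apply: "(\<Sum>i\<in>A. f i) x = (\<Sum>i\<in>A. f i x)"
  for f :: "'i \<Rightarrow> 'k \<Rightarrow> 'd"
  by (induction A rule: infinite_finite_induct) simp_all

text \<open>
  As long as all coefficients \<open>P j\<close> vanish at \<open>0\<close>, they can be divided by the central variable.
\<close>

lemma specialize_polynomial_dependence_at_0:
  fixes v :: "nat \<Rightarrow> 'i \<Rightarrow> 'k \<Rightarrow> 'd"
  assumes "\<And>j i. v j i \<in> polys"
    and "\<And>j. j < N \<Longrightarrow> P j \<in> poly_below m" "\<exists>j<N. P j \<noteq> 0"
    and "\<And>i x. (\<Sum>j<N. P j x * v j i x) = 0"
  shows "\<exists>d. (\<exists>j<N. d j \<noteq> 0) \<and> (\<forall>i. (\<Sum>j<N. d j * v j i 0) = 0)"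
  using assms(2-)
proof (induction m arbitrary: P)
  case 0
  then show ?case by auto
next
  case (Suc m)
  show ?case
  proof (cases "\<exists>j<N. P j 0 \<noteq> 0")
    case True
    then show ?thesis
      using Suc.prems(3) by (intro exI[of _ "\<lambda>j. P j 0"]) auto
  next
    case False
    have "\<exists>g\<in>poly_below m. \<forall>x. P j x = scale x (g x)" if j: "j < N" for j
    proof -
      obtain g c where g: "g \<in> poly_below m" "P j = (\<lambda>x. c + scale x (g x))"
        using Suc.prems(1)[OF j] unfolding poly_below_Suc_iff_bottom by blast
      then have "c = 0"
        using False j by auto
      then show ?thesis
        using g by auto
    qed
    then obtain Q where Q: "\<And>j. j < N \<Longrightarrow> Q j \<in> poly_below m" "\<And>j x. j < N \<Longrightarrow> P j x = scale x (Q j x)"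
      by metis
    have rel: "(\<Sum>j<N. Q j x * v j i x) = 0" for i x
    proof -
      have "(\<Sum>j<N. Q j * v j i) = 0"
      proof (rule poly_eq_0_if_infinite_zeros)
        show "(\<Sum>j<N. Q j * v j i) \<in> polys"
          using Q(1) assms(1) by (intro polys_sum polys_mult) (auto simp: polys_def)
        have "UNIV - {0} \<subseteq> {x. (\<Sum>j<N. Q j * v j i) x = 0}"
        proof
          fix x :: 'k assume "x \<in> UNIV - {0}"
          have "scale x (\<Sum>j<N. Q j x * v j i x) = (\<Sum>j<N. P j x * v j i x)"
            by (simp add: scale_sum_right Q(2) scale_mult_left)
          then show "x \<in> {x. (\<Sum>j<N. Q j * v j i) x = 0}"
            using Suc.prems(3) \<open>x \<in> UNIV - {0}\<close> by (simp add: fun_sum_apply)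
        qed
        then show "infinite {x. (\<Sum>j<N. Q j * v j i) x = 0}"
          using infinite_field infinite_super by (metis finite_Diff2 finite.emptyI finite_insert)
      qed
      then show ?thesis
        using fun_sum_apply[of "\<lambda>j. Q j * v j i" "{..<N}" x] by simp
    qed
    moreover have "\<exists>j<N. Q j \<noteq> 0"
    proof -
      obtain j where "j < N" "P j \<noteq> 0"
        using Suc.prems(2) by blast
      then have "Q j \<noteq> 0"
        using Q(2)[of j] by (auto simp: fun_eq_iff)
      then show ?thesis
        using \<open>j < N\<close> by blast
    qed
    ultimately show ?thesis
      using Suc.IH[of Q] Q(1) by blast
  qed
qed

text \<open>
  Multiplication of \<open>\<Sum> c\<^sub>j (b + x e)^j = 0\<close> by \<open>a^i\<close> from the left, where \<open>a^i\<close> passes \<open>c\<^sub>j \<in> E\<close>, shows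
  that the rows \<open>(a^i (b + x e)^j)\<^sub>i\<close> are linearly dependent over \<open>D\<close>. In contrast to algebraicity
  over \<open>E\<close>, this condition is accessible to elimination: dependence at infinitely many \<open>x\<close> implies
  a dependence with polynomial coefficients, hence one at \<open>x = 0\<close>, from which algebraicity over \<open>E\<close>
  is recovered by \<open>left_algebraic_if_twisted_dependence\<close>.
\<close>

lemma left_algebraic_specialization:
  fixes a b e :: 'd
  assumes "infinite \<Omega>"
    and "\<And>x. x \<in> \<Omega> \<Longrightarrow> \<exists>c. (\<forall>j\<le>n. c j \<in> centralizer a) \<and> (\<exists>j\<le>n. c j \<noteq> 0) \<and>
      (\<Sum>j\<le>n. c j * (b + scale x e) ^ j) = 0"
  shows "left_algebraic_elt (centralizer a) b"
proof -
  define N where "N = Suc n"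
  define v where "v j i x = a ^ i * (b + scale x e) ^ j" for j i x
  have v: "v j i \<in> polys" for j i
  proof -
    have "(\<lambda>_. a ^ i) * (\<lambda>x. ((\<lambda>_. b) + (\<lambda>x. scale (x ^ 1) e)) x ^ j) \<in> polys"
      by (intro polys_mult polys_const polys_power polys_add polys_scale_power)
    also have "(\<lambda>_. a ^ i) * (\<lambda>x. ((\<lambda>_. b) + (\<lambda>x. scale (x ^ 1) e)) x ^ j) = v j i"
      by (simp add: v_def fun_eq_iff)
    finally show ?thesis .
  qed
  have "\<Omega> \<subseteq> {x. \<exists>c. (\<exists>j<N. c j \<noteq> 0) \<and> (\<forall>i. (\<Sum>j<N. c j * v j i x) = 0)}"
  proof
    fix x assume "x \<in> \<Omega>"
    then obtain c where c: "\<And>j. j < N \<Longrightarrow> c j \<in> centralizer a" "\<exists>j<N. c j \<noteq> 0"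
      "(\<Sum>j<N. c j * (b + scale x e) ^ j) = 0"
      using assms(2) by (fastforce simp: N_def less_Suc_eq_le lessThan_Suc_atMost)
    have "(\<Sum>j<N. c j * v j i x) = 0" for i
    proof -
      have "c j * a ^ i = a ^ i * c j" if "j < N" for j
        using power_commuting_commutes[of a "c j" i] c(1)[OF that] by (simp add: centralizer_def)
      then have "(\<Sum>j<N. c j * v j i x) = a ^ i * (\<Sum>j<N. c j * (b + scale x e) ^ j)"
        unfolding v_def sum_distrib_left by (intro sum.cong refl) (simp flip: mult.assoc)
      then show ?thesis
        using c(3) by simp
    qed
    then show "x \<in> {x. \<exists>c. (\<exists>j<N. c j \<noteq> 0) \<and> (\<forall>i. (\<Sum>j<N. c j * v j i x) = 0)}"
      using c(2) by blast
  qed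
  with assms(1) have "infinite {x. \<exists>c. (\<exists>j<N. c j \<noteq> 0) \<and> (\<forall>i. (\<Sum>j<N. c j * v j i x) = 0)}"
    by (rule infinite_super[rotated])
  from rational_dependence_if_infinite_dependences[OF _ this] v
  obtain d where d: "\<forall>j<N. rational (d j)" "\<exists>j<N. \<not> (\<forall>\<^sub>\<infinity>x. d j x = 0)"
      "\<And>i. \<forall>\<^sub>\<infinity>x. (\<Sum>j<N. d j x * v j i x) = 0"
    by blast
  obtain q where q: "q \<in> polys" "q \<noteq> 0" "\<forall>j\<in>{..<N}. \<exists>p\<in>polys. \<forall>\<^sub>\<infinity>x. q x * d j x = p x"
    using rational_common_left_denominator[of "{..<N}" d] d(1) by auto
  then obtain P where P: "\<And>j. j < N \<Longrightarrow> P j \<in> polys" "\<And>j. j < N \<Longrightarrow> \<forall>\<^sub>\<infinity>x. q x * d j x = P j x"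
    by (metis lessThan_iff)
  have "(\<Sum>j<N. P j * v j i) = 0" for i
  proof (rule poly_eq_if_MOST_eq)
    show "(\<Sum>j<N. P j * v j i) \<in> polys"
      using P(1) v by (intro polys_sum polys_mult) auto
    have "\<forall>\<^sub>\<infinity>x. \<forall>j\<in>{..<N}. q x * d j x = P j x"
      using P(2) by (intro eventually_ball_finite) auto
    with d(3)[of i] show "\<forall>\<^sub>\<infinity>x. (\<Sum>j<N. P j * v j i) x = 0 x"
    proof eventually_elim
      case (elim x)
      have "(\<Sum>j<N. P j * v j i) x = q x * (\<Sum>j<N. d j x * v j i x)"
        unfolding fun_sum_apply sum_distrib_left using elim(2) by (intro sum.cong) (auto simp flip: mult.assoc)
      then show ?case
        using elim(1) by simp
    qed
  qed auto
  then have rel: "(\<Sum>j<N. P j x * v j i x) = 0" for i x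
    using fun_sum_apply[of "\<lambda>j. P j * v j i" "{..<N}" x] by simp
  have "\<exists>j<N. P j \<noteq> 0"
  proof -
    obtain j where j: "j < N" "\<not> (\<forall>\<^sub>\<infinity>x. d j x = 0)"
      using d(2) by blast
    have "P j \<noteq> 0"
    proof
      assume "P j = 0"
      have "\<forall>\<^sub>\<infinity>x. d j x = 0"
        using P(2)[OF j(1)] poly_nonzero_MOST[OF q(1,2)] by eventually_elim (auto simp: \<open>P j = 0\<close>)
      then show False
        using j(2) by simp
    qed
    then show ?thesis
      using j(1) by blast
  qed
  moreover obtain m where "\<And>j. j < N \<Longrightarrow> P j \<in> poly_below m"
  proof -
    have "\<exists>m. P j \<in> poly_below m" if "j < N" for j
      using P(1)[OF that] by (auto simp: polys_def)
    then obtain M where "\<And>j. j < N \<Longrightarrow> P j \<in> poly_below (M j)"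
      by metis
    then have "P j \<in> poly_below (Max (M ` {..<N}))" if "j < N" for j
      by (rule poly_below_mono[rotated, OF _ Max_ge]) (use that in simp_all)
    then show thesis
      by (rule that)
  qed
  ultimately have "\<exists>d. (\<exists>j<N. d j \<noteq> 0) \<and> (\<forall>i. (\<Sum>j<N. d j * v j i 0) = 0)"
    using v rel by (intro specialize_polynomial_dependence_at_0[of v N P m])
  then obtain d where d: "\<exists>j<N. d j \<noteq> 0" "\<And>i. (\<Sum>j<N. d j * v j i 0) = 0"
    by (elim exE conjE) blast
  then show ?thesis
    using left_algebraic_if_twisted_dependence[of N d a b] by (simp add: v_def)
qed

lemma left_algebraic_opposite_iff:
  "left_algebraic_elt (centralizer (Op a)) (Op b) \<longleftrightarrow> right_algebraic_elt (centralizer a) b"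
  (is "?L \<longleftrightarrow> ?R") for a b :: 'd
proof -
  have eq: "(\<Sum>i\<le>m. Op (c i) * Op b ^ i) = Op (\<Sum>i\<le>m. b ^ i * c i)" for m and c :: "nat \<Rightarrow> 'd"
    by (simp add: Op_sum Op_simps Op_power)
  have cent: "Op x \<in> centralizer (Op a) \<longleftrightarrow> x \<in> centralizer a" for x :: 'd
    by (auto simp: centralizer_def simp flip: Op_simps)
  show ?thesis
  proof
    assume ?L
    then obtain m c where c: "\<forall>i\<le>m. c i \<in> centralizer (Op a)" "\<exists>i\<le>m. c i \<noteq> 0" "(\<Sum>i\<le>m. c i * Op b ^ i) = 0"
      unfolding left_algebraic_elt_def by blast
    define e where "e i = unop (c i)" for i
    have "c = (\<lambda>i. Op (e i))"
      by (simp add: e_def)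
    with c eq[of e m] cent show ?R
      unfolding right_algebraic_elt_def
      by (intro exI[of _ m] exI[of _ e]) (simp add: Op_eq_0_iff)
  next
    assume ?R
    then obtain m c where c: "\<forall>i\<le>m. c i \<in> centralizer a" "\<exists>i\<le>m. c i \<noteq> 0" "(\<Sum>i\<le>m. b ^ i * c i) = 0"
      unfolding right_algebraic_elt_def by blast
    with eq[of c m] cent show ?L
      unfolding left_algebraic_elt_def
      by (intro exI[of _ m] exI[of _ "\<lambda>i. Op (c i)"]) (simp add: Op_eq_0_iff)
  qed
qed

lemma right_algebraic_specialization:
  fixes a b e :: 'd
  assumes "infinite \<Omega>"
    and "\<And>x. x \<in> \<Omega> \<Longrightarrow> \<exists>c. (\<forall>j\<le>n. c j \<in> centralizer a) \<and> (\<exists>j\<le>n. c j \<noteq> 0) \<and>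
      (\<Sum>j\<le>n. (b + scale x e) ^ j * c j) = 0"
  shows "right_algebraic_elt (centralizer a) b"
proof -
  have "left_algebraic_elt (centralizer (Op a)) (Op b)"
  proof (rule infinite_division_algebra.left_algebraic_specialization[OF opposite_algebra assms(1)])
    fix x assume "x \<in> \<Omega>"
    then obtain c where c: "\<forall>j\<le>n. c j \<in> centralizer a" "\<exists>j\<le>n. c j \<noteq> 0"
      "(\<Sum>j\<le>n. (b + scale x e) ^ j * c j) = 0"
      using assms(2) by blast
    have "(\<Sum>j\<le>n. Op (c j) * (Op b + opp_scale x (Op e)) ^ j) = Op (\<Sum>j\<le>n. (b + scale x e) ^ j * c j)"
      by (simp add: Op_sum Op_simps Op_power)
    moreover have "Op (c j) \<in> centralizer (Op a)" if "j \<le> n" for j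
      using c(1) that by (auto simp: centralizer_def simp flip: Op_simps)
    ultimately show "\<exists>c. (\<forall>j\<le>n. c j \<in> centralizer (Op a)) \<and> (\<exists>j\<le>n. c j \<noteq> 0) \<and>
        (\<Sum>j\<le>n. c j * (Op b + opp_scale x (Op e)) ^ j) = 0"
      using c by (intro exI[of _ "\<lambda>j. Op (c j)"]) (simp add: Op_eq_0_iff)
  qed
  then show ?thesis
    by (simp add: left_algebraic_opposite_iff)
qed

text \<open>
  On the line \<open>b + x (b' - b)\<close>, left algebraicity of degree at most \<open>n\<close> holds for finitely many \<open>x\<close>,
  as it would otherwise hold at \<open>x = 0\<close>; right algebraicity likewise, with \<open>x = 1\<close> instead. The
  parameter \<open>1 - x\<close> moves \<open>b'\<close> to the origin of the line.
\<close>

lemma exists_neither_left_nor_right_algebraic: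
  fixes a :: 'd
  assumes "uncountable (UNIV :: 'k set)"
    and "\<not> left_algebraic_elt (centralizer a) b" "\<not> right_algebraic_elt (centralizer a) b'"
  shows "\<exists>c. \<not> left_algebraic_elt (centralizer a) c \<and> \<not> right_algebraic_elt (centralizer a) c"
proof (rule ccontr)
  assume neg: "\<not> ?thesis"
  define A where "A n = {x. \<exists>c. (\<forall>j\<le>n. c j \<in> centralizer a) \<and> (\<exists>j\<le>n. c j \<noteq> 0) \<and>
      (\<Sum>j\<le>n. c j * (b + scale x (b' - b)) ^ j) = 0}" for n
  define B where "B n = {x. \<exists>c. (\<forall>j\<le>n. c j \<in> centralizer a) \<and> (\<exists>j\<le>n. c j \<noteq> 0) \<and>
      (\<Sum>j\<le>n. (b + scale x (b' - b)) ^ j * c j) = 0}" for n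
  have A: "finite (A n)" for n
  proof (rule ccontr)
    assume "infinite (A n)"
    then have "left_algebraic_elt (centralizer a) b"
      by (rule left_algebraic_specialization) (auto simp: A_def)
    with assms(2) show False ..
  qed
  have B: "finite (B n)" for n
  proof (rule ccontr)
    assume "infinite (B n)"
    then have "infinite ((\<lambda>x. 1 - x) ` B n)"
      using finite_imageD[of "\<lambda>x. 1 - x" "B n"] by (auto simp: inj_on_def)
    then have "right_algebraic_elt (centralizer a) b'"
    proof (rule right_algebraic_specialization)
      fix x assume "x \<in> (\<lambda>x. 1 - x) ` B n"
      then obtain y where y: "y \<in> B n" "x = 1 - y"
        by blast
      have "b + scale y (b' - b) = b' + scale x (b - b')"
        by (simp add: y(2) scale_left_diff_distrib scale_right_diff_distrib)
      then show "\<exists>c. (\<forall>j\<le>n. c j \<in> centralizer a) \<and> (\<exists>j\<le>n. c j \<noteq> 0) \<and>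
          (\<Sum>j\<le>n. (b' + scale x (b - b')) ^ j * c j) = 0"
        using y(1) by (simp add: B_def)
    qed
    with assms(3) show False ..
  qed
  have "x \<in> (\<Union>n. A n \<union> B n)" for x
  proof -
    consider "left_algebraic_elt (centralizer a) (b + scale x (b' - b))"
      | "right_algebraic_elt (centralizer a) (b + scale x (b' - b))"
      using neg by blast
    then show ?thesis
      by cases (auto simp: left_algebraic_elt_def right_algebraic_elt_def A_def B_def)
  qed
  then have "UNIV = (\<Union>n. A n \<union> B n)"
    by blast
  moreover have "countable (\<Union>n. A n \<union> B n)"
    using A B by (intro countable_UN) (auto intro: countable_finite)
  ultimately show False
    using assms(1) by simp
qed

end

section \<open>Evaluation of the free algebra\<close>

lemma poly_mapping_eq_sum_single:
  assumes "finite A" "Poly_Mapping.keys f \<subseteq> A"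
  shows "f = (\<Sum>w\<in>A. Poly_Mapping.single w (Poly_Mapping.lookup f w))"
proof (rule poly_mapping_eqI)
  fix t
  show "Poly_Mapping.lookup f t =
      Poly_Mapping.lookup (\<Sum>w\<in>A. Poly_Mapping.single w (Poly_Mapping.lookup f w)) t"
    using assms by (auto simp: lookup_sum lookup_single when_def in_keys_iff)
qed

lemma letters_add: "letters (u + v) = letters u @ letters v"
  by (simp add: plus_free_monoid_def)

lemma letters_zero: "letters 0 = []"
  by (simp add: zero_free_monoid_def)

context k_algebra
begin

definition word_value :: "('x \<Rightarrow> 'a) \<Rightarrow> 'x free_monoid \<Rightarrow> 'a" where
  "word_value v w = prod_list (map v (letters w))"

definition free_eval :: "('x \<Rightarrow> 'a) \<Rightarrow> ('x free_monoid \<Rightarrow>\<^sub>0 'k) \<Rightarrow> 'a" where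
  "free_eval v f = (\<Sum>w\<in>Poly_Mapping.keys f. scale (Poly_Mapping.lookup f w) (word_value v w))"

lemma word_value_add: "word_value v (u + w) = word_value v u * word_value v w"
  by (simp add: word_value_def letters_add)

lemma free_eval_superset:
  assumes "finite A" "Poly_Mapping.keys f \<subseteq> A"
  shows "free_eval v f = (\<Sum>w\<in>A. scale (Poly_Mapping.lookup f w) (word_value v w))"
  unfolding free_eval_def using assms by (intro sum.mono_neutral_left) (auto simp: in_keys_iff)

lemma free_eval_add: "free_eval v (f + g) = free_eval v f + free_eval v g"
proof -
  let ?A = "Poly_Mapping.keys f \<union> Poly_Mapping.keys g"
  show ?thesis
    using free_eval_superset[of ?A f] free_eval_superset[of ?A g] free_eval_superset[of ?A "f + g"]
      Poly_Mapping.keys_add[of f g]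
    by (simp add: lookup_add scale_left_distrib sum.distrib)
qed

lemma free_eval_zero [simp]: "free_eval v 0 = 0"
  by (simp add: free_eval_def)

lemma free_eval_diff: "free_eval v (f - g) = free_eval v f - free_eval v g"
  using free_eval_add[of v "f - g" g] by simp

lemma free_eval_single: "free_eval v (Poly_Mapping.single w c) = scale c (word_value v w)"
  by (simp add: free_eval_def)

lemma free_eval_scale: "free_eval v (free_scale c f) = scale c (free_eval v f)"
proof -
  have "Poly_Mapping.keys (free_scale c f) \<subseteq> Poly_Mapping.keys f"
    by (auto simp: in_keys_iff)
  then show ?thesis
    using free_eval_superset[of "Poly_Mapping.keys f" "free_scale c f"]
      free_eval_superset[of "Poly_Mapping.keys f" f] by (simp add: scale_sum_right)
qed

lemma free_eval_mult: "free_eval v (f * g) = free_eval v f * free_eval v g"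
proof (induction f rule: poly_mapping_add_single_induct)
  case (add_single f u c)
  have "free_eval v (Poly_Mapping.single u c * g) = free_eval v (Poly_Mapping.single u c) * free_eval v g"
  proof (induction g rule: poly_mapping_add_single_induct)
    case (add_single g w d)
    then show ?case
      by (simp add: distrib_left free_eval_add mult_single free_eval_single word_value_add
          scale_mult_left scale_mult_right mult.commute)
  qed simp
  with add_single show ?case
    by (simp add: distrib_right free_eval_add)
qed simp

lemma free_eval_one: "free_eval v 1 = 1"
  using free_eval_single[of v 0 1] by (simp add: word_value_def letters_zero)

lemma free_eval_gen: "free_eval v (free_gen i) = v i"
  by (simp add: free_gen_def free_eval_single word_value_def)

lemma algebra_hom_free_eval: "algebra_hom free_scale scale (free_eval v)"
  by (simp add: algebra_hom_def free_eval_one free_eval_add free_eval_mult free_eval_scale)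

lemma range_free_eval: "range (free_eval v) = subalgebra scale hull range v"
proof (rule hull_unique[symmetric])
  show "range v \<subseteq> range (free_eval v)"
    using free_eval_gen by (metis image_subset_iff rangeI)
  show "subalgebra scale (range (free_eval v))"
    unfolding subalgebra_def
    by (auto simp flip: free_eval_add free_eval_mult free_eval_scale) (metis free_eval_one rangeI)
next
  fix S assume S: "range v \<subseteq> S" "subalgebra scale S"
  have word: "word_value v w \<in> S" for w
  proof -
    have "prod_list (map v xs) \<in> S" for xs
      using S by (induction xs) (auto simp: subalgebra_def)
    then show ?thesis
      by (simp add: word_value_def)
  qed
  have zero: "0 \<in> S"
  proof -
    have "scale 0 1 \<in> S"
      using S(2) unfolding subalgebra_def by blast
    then show ?thesis
      by simp
  qed
  have "free_eval v f \<in> S" for f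
  proof (induction f rule: poly_mapping_add_single_induct)
    case (add_single f w c)
    then show ?case
      using S(2) word[of w] by (simp add: free_eval_add free_eval_single subalgebra_def)
  qed (simp add: zero)
  then show "range (free_eval v) \<subseteq> S"
    by blast
qed

lemma free_on_if_inj_free_eval:
  assumes "inj (free_eval v)"
  shows "free_on scale v"
  unfolding free_on_def
  by (rule exI[of _ "free_eval v"])
    (simp add: algebra_hom_free_eval free_eval_gen bij_betw_def assms range_free_eval)

end

text \<open>
  The word \<open>v'\<close> ends where the marker's letter \<open>True\<close> stands. If \<open>v\<close> were shorter, by at most \<open>M\<close>
  letters, this position would lie within the block of letters \<open>False\<close> of the marker that follows \<open>v\<close>.
\<close>

lemma marker_factorization_unique:
  assumes "v @ (True # replicate M False) @ w = v' @ (True # replicate M False) @ w'"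
    and "length v \<le> M" "length v' \<le> M"
  shows "v = v' \<and> w = w'"
proof -
  have le: "length v' \<le> length v"
    if eq: "v @ (True # replicate M False) @ w = v' @ (True # replicate M False) @ w'"
      and len: "length v' \<le> M" for v v' w w'
  proof (rule ccontr)
    assume "\<not> ?thesis"
    then obtain k where k: "length v' = length v + Suc k"
      using less_imp_Suc_add by (metis add_Suc_right linorder_not_le)
    have "(v @ (True # replicate M False) @ w) ! length v' = False"
      using k len by (simp add: nth_append)
    moreover have "(v' @ (True # replicate M False) @ w') ! length v' = True"
      by (simp add: nth_append)
    ultimately show False
      using eq by simp
  qed
  have "length v = length v'"
    using le[OF assms(1,3)] le[OF assms(1)[symmetric] assms(2)] by simp
  then show ?thesis
    using assms(1) by simp
qed

lemma lookup_sandwich_marker: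
  fixes f g :: "bool free_monoid \<Rightarrow>\<^sub>0 'k::field"
  assumes "\<And>v. v \<in> Poly_Mapping.keys f \<Longrightarrow> length (letters v) \<le> M" "length (letters v) \<le> M"
  defines "z \<equiv> Monomial (True # replicate M False)"
  shows "Poly_Mapping.lookup (f * Poly_Mapping.single z 1 * g) (v + z + w) =
    Poly_Mapping.lookup f v * Poly_Mapping.lookup g w"
proof -
  have unique: "v' + z + w' = v + z + w \<longleftrightarrow> v' = v \<and> w' = w" if "length (letters v') \<le> M" for v' w'
  proof
    assume "v' + z + w' = v + z + w"
    then have "letters v' @ (True # replicate M False) @ letters w' = letters v @ (True # replicate M False) @ letters w"
      by (simp add: plus_free_monoid_def z_def)
    from marker_factorization_unique[OF this that assms(2)] show "v' = v \<and> w' = w"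
      by (simp add: free_monoid.expand)
  qed simp
  have "f * Poly_Mapping.single z 1 * g =
      (\<Sum>v'\<in>Poly_Mapping.keys f. Poly_Mapping.single v' (Poly_Mapping.lookup f v')) * Poly_Mapping.single z 1 *
      (\<Sum>w'\<in>Poly_Mapping.keys g. Poly_Mapping.single w' (Poly_Mapping.lookup g w'))"
    using poly_mapping_eq_sum_single[of "Poly_Mapping.keys f" f]
      poly_mapping_eq_sum_single[of "Poly_Mapping.keys g" g] by simp
  also have "\<dots> = (\<Sum>v'\<in>Poly_Mapping.keys f. \<Sum>w'\<in>Poly_Mapping.keys g.
      Poly_Mapping.single (v' + z + w') (Poly_Mapping.lookup f v' * Poly_Mapping.lookup g w'))"
    by (subst sum_distrib_right, subst sum_product) (simp add: mult_single)
  finally have "Poly_Mapping.lookup (f * Poly_Mapping.single z 1 * g) (v + z + w) =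
      (\<Sum>v'\<in>Poly_Mapping.keys f. \<Sum>w'\<in>Poly_Mapping.keys g.
        if v' = v \<and> w' = w then Poly_Mapping.lookup f v' * Poly_Mapping.lookup g w' else 0)"
    using assms(1) by (simp add: lookup_sum lookup_single when_def unique)
  also have "\<dots> = (\<Sum>v'\<in>Poly_Mapping.keys f. if v' = v then
      (\<Sum>w'\<in>Poly_Mapping.keys g. if w' = w then Poly_Mapping.lookup f v' * Poly_Mapping.lookup g w' else 0) else 0)"
    by (intro sum.cong refl) auto
  also have "\<dots> = Poly_Mapping.lookup f v * Poly_Mapping.lookup g w"
    by (simp add: in_keys_iff)
  finally show ?thesis .
qed

text \<open>
  A comparison of coefficients at \<open>v + z + w\<close> for a marker \<open>z\<close> gives \<open>f\<^sub>v g\<^sub>w = g\<^sub>v f\<^sub>w\<close>.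
\<close>

lemma proportional_if_sandwiches_commute:
  fixes f g :: "bool free_monoid \<Rightarrow>\<^sub>0 'k::field"
  assumes "f \<noteq> 0" "\<And>z. f * Poly_Mapping.single z 1 * g = g * Poly_Mapping.single z 1 * f"
  shows "\<exists>c. g = free_scale c f"
proof -
  define M where "M = Max (insert 0 ((length \<circ> letters) ` (Poly_Mapping.keys f \<union> Poly_Mapping.keys g)))"
  have M: "length (letters v) \<le> M" if "v \<in> Poly_Mapping.keys f \<union> Poly_Mapping.keys g" for v
    unfolding M_def using that by (intro Max_ge) auto
  define z where "z = Monomial (True # replicate M False)"
  have cross: "Poly_Mapping.lookup f v * Poly_Mapping.lookup g w = Poly_Mapping.lookup g v * Poly_Mapping.lookup f w"
    if "length (letters v) \<le> M" for v w
    using lookup_sandwich_marker[of f M v g w] lookup_sandwich_marker[of g M v f w] assms(2)[of z] M that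
    by (simp add: z_def)
  obtain v where v: "v \<in> Poly_Mapping.keys f"
    using assms(1) by fastforce
  define c where "c = Poly_Mapping.lookup g v / Poly_Mapping.lookup f v"
  have "g = free_scale c f"
  proof (rule poly_mapping_eqI)
    fix w
    have "Poly_Mapping.lookup f v \<noteq> 0"
      using v by (simp add: in_keys_iff)
    then show "Poly_Mapping.lookup g w = Poly_Mapping.lookup (free_scale c f) w"
      using cross[of v w] M[of v] v by (simp add: c_def field_simps)
  qed
  then show ?thesis ..
qed

text \<open>
  The elements with coefficients in the prime ring of \<open>k\<close>. In contrast to the whole free algebra
  there are only countably many.
\<close>

definition integral_elements :: "('x free_monoid \<Rightarrow>\<^sub>0 'k::field) set" where
  "integral_elements = {f. \<forall>w. Poly_Mapping.lookup f w \<in> \<int>}"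

lemma integral_elements_diff: "f \<in> integral_elements \<Longrightarrow> g \<in> integral_elements \<Longrightarrow> f - g \<in> integral_elements"
  by (simp add: integral_elements_def lookup_minus)

lemma integral_elements_single_one: "Poly_Mapping.single w 1 \<in> integral_elements"
  by (simp add: integral_elements_def lookup_single when_def)

lemma integral_elements_sum:
  "(\<And>i. i \<in> A \<Longrightarrow> f i \<in> integral_elements) \<Longrightarrow> (\<Sum>i\<in>A. f i) \<in> integral_elements"
  by (auto simp: integral_elements_def lookup_sum intro!: Ints_sum)

lemma integral_elements_mult:
  assumes "f \<in> integral_elements" "g \<in> integral_elements"
  shows "f * g \<in> integral_elements"
proof -
  have "f * g = (\<Sum>v\<in>Poly_Mapping.keys f. Poly_Mapping.single v (Poly_Mapping.lookup f v)) *
      (\<Sum>w\<in>Poly_Mapping.keys g. Poly_Mapping.single w (Poly_Mapping.lookup g w))"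
    using poly_mapping_eq_sum_single[of "Poly_Mapping.keys f" f]
      poly_mapping_eq_sum_single[of "Poly_Mapping.keys g" g] by simp
  also have "\<dots> = (\<Sum>v\<in>Poly_Mapping.keys f. \<Sum>w\<in>Poly_Mapping.keys g.
      Poly_Mapping.single (v + w) (Poly_Mapping.lookup f v * Poly_Mapping.lookup g w))"
    by (simp add: sum_product mult_single)
  also have "\<dots> \<in> integral_elements"
    using assms by (intro integral_elements_sum) (simp add: integral_elements_def lookup_single when_def)
  finally show ?thesis .
qed

lemma countable_integral_elements:
  "countable (integral_elements :: (bool free_monoid \<Rightarrow>\<^sub>0 'k::field) set)"
proof -
  define \<Psi> :: "(bool list \<times> int) list \<Rightarrow> bool free_monoid \<Rightarrow>\<^sub>0 'k"
    where "\<Psi> L = (\<Sum>(w, m)\<leftarrow>L. Poly_Mapping.single (Monomial w) (of_int m))" for L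
  have "integral_elements \<subseteq> range \<Psi>"
  proof
    fix f :: "bool free_monoid \<Rightarrow>\<^sub>0 'k"
    assume f: "f \<in> integral_elements"
    then have "\<exists>m. Poly_Mapping.lookup f w = of_int m" for w
      by (auto simp: integral_elements_def elim: Ints_cases)
    then obtain m where m: "\<And>w. Poly_Mapping.lookup f w = of_int (m w)"
      by metis
    obtain xs where xs: "set xs = Poly_Mapping.keys f" "distinct xs"
      using finite_distinct_list[of "Poly_Mapping.keys f"] by auto
    have "\<Psi> (map (\<lambda>w. (letters w, m w)) xs) = (\<Sum>w\<leftarrow>xs. Poly_Mapping.single w (Poly_Mapping.lookup f w))"
      by (simp add: \<Psi>_def m comp_def)
    also have "\<dots> = f"
      using xs poly_mapping_eq_sum_single[of "Poly_Mapping.keys f" f]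
      by (simp add: sum_list_distinct_conv_sum_set)
    finally show "f \<in> range \<Psi>"
      by (metis rangeI)
  qed
  then show ?thesis
    by (rule countable_subset) simp
qed

context k_algebra
begin

text \<open>
  Every \<open>g\<close> is a combination \<open>\<Sum> c\<^sub>i f\<^sub>i\<close> with \<open>c\<^sub>i \<in> k\<close> and integral \<open>f\<^sub>i\<close>. Suppose that \<open>g\<close> lies in the
  kernel and argue by induction on the number of terms. For the last \<open>f\<^sub>n \<noteq> 0\<close> and any word \<open>z\<close>, the
  element \<open>f\<^sub>n z g - g z f\<^sub>n\<close> also lies in the kernel and needs one term less, so it vanishes. Hence
  \<open>g\<close> is a multiple of \<open>f\<^sub>n\<close>, which is not in the kernel.
\<close>

lemma inj_free_eval_if_integral_kernel_trivial:
  fixes v :: "bool \<Rightarrow> 'a"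
  assumes "\<And>f. f \<in> integral_elements \<Longrightarrow> free_eval v f = 0 \<Longrightarrow> f = 0"
  shows "inj (free_eval v)"
proof -
  interpret free: k_algebra "free_scale :: 'k \<Rightarrow> (bool free_monoid \<Rightarrow>\<^sub>0 'k) \<Rightarrow> _"
    by (rule k_algebra_free_scale)
  define combo where "combo n g \<longleftrightarrow>
    (\<exists>c f. g = (\<Sum>i<n. free_scale (c i) (f i)) \<and> (\<forall>i<n. f i \<in> integral_elements))"
    for n :: nat and g :: "bool free_monoid \<Rightarrow>\<^sub>0 'k"
  have ex_combo: "\<exists>n. combo n g" for g
  proof (induction g rule: poly_mapping_add_single_induct)
    case zero
    have "combo 0 0"
      by (simp add: combo_def)
    then show ?case ..
  next
    case (add_single g w d)
    then obtain n :: nat and c f where *: "g = (\<Sum>i<n. free_scale (c i) (f i))" "\<forall>i<n. f i \<in> integral_elements"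
      unfolding combo_def by blast
    have "free_scale d (Poly_Mapping.single w 1) = Poly_Mapping.single w d"
      by (rule poly_mapping_eqI) (simp add: lookup_single when_def)
    then have "g + Poly_Mapping.single w d =
        (\<Sum>i<Suc n. free_scale ((c(n := d)) i) ((f(n := Poly_Mapping.single w 1)) i))"
      by (simp add: *)
    moreover have "\<forall>i<Suc n. (f(n := Poly_Mapping.single w 1)) i \<in> integral_elements"
      using *(2) by (simp add: integral_elements_single_one less_Suc_eq)
    ultimately have "combo (Suc n) (g + Poly_Mapping.single w d)"
      unfolding combo_def by blast
    then show ?case ..
  qed
  have "g = 0" if "combo n g" "free_eval v g = 0" for n g
    using that
  proof (induction n arbitrary: g)
    case 0
    then show ?case
      by (simp add: combo_def)
  next
    case (Suc n)
    then obtain c f where g: "g = (\<Sum>i<n. free_scale (c i) (f i)) + free_scale (c n) (f n)"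
      and f: "\<And>i. i < Suc n \<Longrightarrow> f i \<in> integral_elements"
      by (auto simp: combo_def)
    show ?case
    proof (cases "f n = 0")
      case True
      then have "g = (\<Sum>i<n. free_scale (c i) (f i))"
        by (simp add: g)
      then have "combo n g"
        unfolding combo_def using f by (intro exI[of _ c] exI[of _ f]) simp
      then show ?thesis
        using Suc by blast
    next
      case False
      have "f n * Poly_Mapping.single z 1 * g - g * Poly_Mapping.single z 1 * f n = 0" for z
      proof (rule Suc.IH)
        let ?z = "Poly_Mapping.single z (1 :: 'k)"
        have "f n * ?z * g - g * ?z * f n =
            (\<Sum>i<n. free_scale (c i) (f n * ?z * f i - f i * ?z * f n))"
          by (simp add: g distrib_left distrib_right sum_distrib_left sum_distrib_right
              free.scale_mult_left free.scale_mult_right free.scale_right_diff_distrib sum_subtractf)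
        moreover have "\<forall>i<n. f n * ?z * f i - f i * ?z * f n \<in> integral_elements"
          using f by (auto intro!: integral_elements_diff integral_elements_mult integral_elements_single_one)
        ultimately show "combo n (f n * ?z * g - g * ?z * f n)"
          unfolding combo_def by (intro exI[of _ c] exI[of _ "\<lambda>i. f n * ?z * f i - f i * ?z * f n"] conjI)
        show "free_eval v (f n * ?z * g - g * ?z * f n) = 0"
          by (simp add: free_eval_diff free_eval_mult Suc.prems(2))
      qed
      then obtain d where d: "g = free_scale d (f n)"
        using proportional_if_sandwiches_commute[OF False, of g] by auto
      have "scale d (free_eval v (f n)) = 0"
        using Suc.prems(2) by (simp add: d free_eval_scale)
      moreover have "free_eval v (f n) \<noteq> 0"
        using assms[of "f n"] f False by auto
      ultimately show ?thesis
        by (simp add: d)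
    qed
  qed
  then have "g = 0" if "free_eval v g = 0" for g
    using ex_combo[of g] that by blast
  then show ?thesis
    by (intro injI) (metis free_eval_diff right_minus_eq)
qed

end

context infinite_division_algebra
begin

section \<open>Generic parameters\<close>

text \<open>
  An instance of \<open>iterated_words_independent\<close> in the ring of functions of \<open>(\<mu>, \<lambda>)\<close>, written \<open>x\<close> and
  \<open>l\<close> below. The coefficients are rational in \<open>x\<close>, those that vanish outside a finite set are
  null, and the module \<open>N\<close> consists of the functions that are polynomial in \<open>l\<close> along the relation,
  that is, for almost all \<open>x \<in> \<Omega>\<close> and almost all \<open>l\<close> with \<open>free_eval \<dots> g = 0\<close>. By the choice of this
  domain the sum of words that belongs to \<open>g\<close> is in \<open>N\<close>.
\<close>

lemma finite_bad_parameters: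
  fixes a b :: 'd and g :: "bool free_monoid \<Rightarrow>\<^sub>0 'k"
  defines "z \<equiv> \<lambda>x. inverse (scale x 1 - b ^ 2)" and "y \<equiv> \<lambda>l. inverse (scale l 1 - a)"
  assumes nl: "\<not> left_algebraic_elt (centralizer a) b" and nr: "\<not> right_algebraic_elt (centralizer a) b"
    and "g \<noteq> 0"
  shows "finite {x. infinite {l. free_eval (\<lambda>i. if i then z x * y l else b * z x * y l) g = 0}}"
proof (rule ccontr)
  define \<beta> where "\<beta> i x = (if i then z x else b * z x)" for i x
  define \<Lambda> where "\<Lambda> x = {l. free_eval (\<lambda>i. \<beta> i x * y l) g = 0}" for x
  define \<Omega> where "\<Omega> = {x. infinite (\<Lambda> x)}"
  have letter: "(\<lambda>i. if i then z x * y l else b * z x * y l) = (\<lambda>i. \<beta> i x * y l)" for x l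
    by (auto simp: \<beta>_def)
  assume "infinite {x. infinite {l. free_eval (\<lambda>i. if i then z x * y l else b * z x * y l) g = 0}}"
  then have inf: "infinite \<Omega>"
    by (simp add: \<Omega>_def \<Lambda>_def letter)

  \<comment> \<open>This makes \<open>y l\<close> an inverse of \<open>l - a\<close> for every \<open>l\<close>, without exceptions.\<close>
  have a_not_scalar: "scale l 1 - a \<noteq> 0" for l
  proof
    assume "scale l 1 - a = 0"
    then have "centralizer a = UNIV"
      using scalar_commute[of l] by (auto simp: centralizer_def)
    then have "left_algebraic_elt (centralizer a) b"
      by (intro left_algebraic_eltI[of 2 "\<lambda>i. if i = 0 then - b else 1" _ 1])
        (simp_all add: numeral_2_eq_2)
    then show False
      using nl by simp
  qed
  have "rational (\<lambda>x. inverse (((\<lambda>x. scale x 1) - (\<lambda>_. b ^ 2)) x))"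
    by (intro rational_inverse rational_diff rational_poly polys_scalar polys_const)
  then have z: "rational z"
    by (simp add: z_def)
  then have "rational ((\<lambda>_. b) * z)"
    by (intro rational_mult rational_const)
  then have \<beta>: "rational (\<beta> i)" for i
    using z by (cases i) (simp_all add: \<beta>_def[abs_def] times_fun_def)

  define K :: "('k \<Rightarrow> 'k \<Rightarrow> 'd) set" where "K = {\<lambda>x l. f x | f. rational f}"
  define Z :: "('k \<Rightarrow> 'k \<Rightarrow> 'd) set" where "Z = {\<lambda>x l. f x | f. rational f \<and> (\<forall>\<^sub>\<infinity>x. f x = 0)}"
  define N :: "('k \<Rightarrow> 'k \<Rightarrow> 'd) set" where
    "N = {n. \<forall>\<^sub>\<infinity>x. x \<in> \<Omega> \<longrightarrow> (\<exists>P\<in>polys. \<forall>\<^sub>\<infinity>l. l \<in> \<Lambda> x \<longrightarrow> n x l = P l)}"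
  define W where "W = iterated_word (\<lambda>(x :: 'k) l. y l) (\<lambda>i x (l :: 'k). \<beta> i x)"
  have KI: "(\<lambda>x l. f x) \<in> K" if "rational f" for f
    using that by (auto simp: K_def)
  have KE: "\<exists>f. d = (\<lambda>x l. f x) \<and> rational f" if "d \<in> K" for d
    using that by (auto simp: K_def)
  have ZI: "(\<lambda>x l. f x) \<in> Z" if "rational f" "\<forall>\<^sub>\<infinity>x. f x = 0" for f
    using that by (auto simp: Z_def)
  have ZE: "\<exists>f. d = (\<lambda>x l. f x) \<and> rational f \<and> (\<forall>\<^sub>\<infinity>x. f x = 0)" if "d \<in> Z" for d
    using that by (auto simp: Z_def)
  have Z_iff: "(\<lambda>x l. f x) \<in> Z \<longleftrightarrow> rational f \<and> (\<forall>\<^sub>\<infinity>x. f x = 0)" for f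
  proof
    assume "(\<lambda>x l. f x) \<in> Z"
    then obtain h where h: "(\<lambda>x (l :: 'k). f x) = (\<lambda>x l. h x)" "rational h" "\<forall>\<^sub>\<infinity>x. h x = 0"
      using ZE by blast
    have "f = h"
      using fun_cong[OF fun_cong[OF h(1)]] by (intro ext) simp
    with h show "rational f \<and> (\<forall>\<^sub>\<infinity>x. f x = 0)"
      by simp
  qed (use ZI in blast)
  have NI: "n \<in> N" if "\<forall>\<^sub>\<infinity>x. x \<in> \<Omega> \<longrightarrow> (\<exists>P\<in>polys. \<forall>\<^sub>\<infinity>l. l \<in> \<Lambda> x \<longrightarrow> n x l = P l)" for n
    using that by (simp add: N_def)
  have ND: "\<forall>\<^sub>\<infinity>x. x \<in> \<Omega> \<longrightarrow> (\<exists>P\<in>polys. \<forall>\<^sub>\<infinity>l. l \<in> \<Lambda> x \<longrightarrow> n x l = P l)" if "n \<in> N" for n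
    using that by (simp add: N_def)
  define n where "n = Max (insert 0 ((length \<circ> letters) ` Poly_Mapping.keys g))"
  have n: "length (letters w) \<le> n" if "w \<in> Poly_Mapping.keys g" for w
    unfolding n_def using that by (intro Max_ge) auto
  define d where "d I = (\<lambda>(x :: 'k) (l :: 'k). scale (Poly_Mapping.lookup g (Monomial I)) (1 :: 'd))" for I

  have vanish: "d I \<in> Z" if "length I \<le> n" for I
  proof (rule iterated_words_independent[where K = K and Z = Z and N = N and n = n
        and l = "\<lambda>x l. scale l 1 - a" and a = "\<lambda>x l. a" and y = "\<lambda>x l. y l"
        and b = "\<lambda>i x l. \<beta> i x"])
    show "1 \<in> K"
      using KI[of 1] by (auto simp: one_fun_def intro: rational_const)
  next
    fix d e assume "d \<in> K" "e \<in> K"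
    then obtain f h where *: "d = (\<lambda>x l. f x)" "e = (\<lambda>x l. h x)" "rational f" "rational h"
      using KE by metis
    show "d - e \<in> K"
      using KI[OF rational_diff[OF *(3,4)]] by (simp add: * fun_diff_def)
    show "d * e \<in> K"
      using KI[OF rational_mult[OF *(3,4)]] by (simp add: * times_fun_def)
  next
    show "0 \<in> Z"
      using ZI[of 0] by (simp add: zero_fun_def rational_const)
  next
    fix d e assume "d \<in> Z" "e \<in> Z"
    then obtain f h where *: "d = (\<lambda>x l. f x)" "e = (\<lambda>x l. h x)" "rational f" "rational h"
      "\<forall>\<^sub>\<infinity>x. f x = 0" "\<forall>\<^sub>\<infinity>x. h x = 0"
      using ZE by metis
    have "\<forall>\<^sub>\<infinity>x. (f - h) x = 0"
      using *(5,6) by eventually_elim simp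
    then show "d - e \<in> Z"
      using ZI[OF rational_diff[OF *(3,4)]] by (simp add: * fun_diff_def)
  next
    fix d e assume "d \<in> K" "e \<in> Z"
    then obtain f h where *: "d = (\<lambda>x l. f x)" "e = (\<lambda>x l. h x)" "rational f" "rational h" "\<forall>\<^sub>\<infinity>x. h x = 0"
      using KE ZE by metis
    have "\<forall>\<^sub>\<infinity>x. (f * h) x = 0" "\<forall>\<^sub>\<infinity>x. (h * f) x = 0"
      using *(5) by (auto elim: eventually_mono)
    then show "d * e \<in> Z" "e * d \<in> Z"
      using ZI[OF rational_mult[OF *(3,4)]] ZI[OF rational_mult[OF *(4,3)]]
      by (simp_all add: * times_fun_def)
  next
    fix d assume "d \<in> K" "d \<notin> Z"
    then obtain f where f: "d = (\<lambda>x l. f x)" "rational f"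
      using KE by metis
    with \<open>d \<notin> Z\<close> have nz: "\<forall>\<^sub>\<infinity>x. f x \<noteq> 0"
      using rational_zero_or_nonzero[OF f(2)] ZI by blast
    have "\<forall>\<^sub>\<infinity>x. ((\<lambda>x. inverse (f x)) * f - (\<lambda>_. 1)) x = 0"
      using nz by eventually_elim simp
    moreover have "rational ((\<lambda>x. inverse (f x)) * f - (\<lambda>_. 1))"
      using f(2) by (intro rational_diff rational_mult rational_inverse rational_const)
    ultimately have "(\<lambda>x l. ((\<lambda>x. inverse (f x)) * f - (\<lambda>_. 1)) x) \<in> Z"
      by (intro ZI)
    also have "(\<lambda>x l. ((\<lambda>x. inverse (f x)) * f - (\<lambda>_. 1)) x) = (\<lambda>x l. inverse (f x)) * d - 1"
      by (simp add: f(1) fun_eq_iff)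
    finally show "\<exists>d'\<in>K. d' * d - 1 \<in> Z"
      using KI[OF rational_inverse[OF f(2)]] by (intro bexI)
  next
    show "K \<subseteq> N"
    proof
      fix d assume "d \<in> K"
      then obtain f where f: "d = (\<lambda>x l. f x)"
        using KE by metis
      show "d \<in> N"
        by (rule NI) (auto simp: f intro!: always_eventually)
    qed
  next
    fix m m' assume "m \<in> N" "m' \<in> N"
    show "m - m' \<in> N"
    proof (rule NI)
      show "\<forall>\<^sub>\<infinity>x. x \<in> \<Omega> \<longrightarrow> (\<exists>P\<in>polys. \<forall>\<^sub>\<infinity>l. l \<in> \<Lambda> x \<longrightarrow> (m - m') x l = P l)"
        using ND[OF \<open>m \<in> N\<close>] ND[OF \<open>m' \<in> N\<close>]
      proof eventually_elim
        case (elim x)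
        show ?case
        proof
          assume "x \<in> \<Omega>"
          then obtain P P' where P: "P \<in> polys" "\<forall>\<^sub>\<infinity>l. l \<in> \<Lambda> x \<longrightarrow> m x l = P l"
            "P' \<in> polys" "\<forall>\<^sub>\<infinity>l. l \<in> \<Lambda> x \<longrightarrow> m' x l = P' l"
            using elim by blast
          have "\<forall>\<^sub>\<infinity>l. l \<in> \<Lambda> x \<longrightarrow> (m - m') x l = (P - P') l"
            using P(2,4) by eventually_elim simp
          then show "\<exists>P\<in>polys. \<forall>\<^sub>\<infinity>l. l \<in> \<Lambda> x \<longrightarrow> (m - m') x l = P l"
            using polys_diff[OF P(1,3)] by (intro bexI[of _ "P - P'"])
        qed
      qed
    qed
  next
    fix d m assume "d \<in> K" "m \<in> N"
    then obtain f where f: "d = (\<lambda>x l. f x)"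
      using KE by metis
    show "d * m \<in> N"
    proof (rule NI)
      show "\<forall>\<^sub>\<infinity>x. x \<in> \<Omega> \<longrightarrow> (\<exists>P\<in>polys. \<forall>\<^sub>\<infinity>l. l \<in> \<Lambda> x \<longrightarrow> (d * m) x l = P l)"
        using ND[OF \<open>m \<in> N\<close>]
      proof eventually_elim
        case (elim x)
        show ?case
        proof
          assume "x \<in> \<Omega>"
          then obtain P where P: "P \<in> polys" "\<forall>\<^sub>\<infinity>l. l \<in> \<Lambda> x \<longrightarrow> m x l = P l"
            using elim by blast
          have "\<forall>\<^sub>\<infinity>l. l \<in> \<Lambda> x \<longrightarrow> (d * m) x l = ((\<lambda>_. f x) * P) l"
            using P(2) by eventually_elim (simp add: f)
          then show "\<exists>P\<in>polys. \<forall>\<^sub>\<infinity>l. l \<in> \<Lambda> x \<longrightarrow> (d * m) x l = P l"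
            using polys_mult[OF polys_const P(1)] by (intro bexI[of _ "(\<lambda>_. f x) * P"])
        qed
      qed
    qed
  next
    fix m assume "m \<in> N"
    show "(\<lambda>x l. scale l 1 - a) * m \<in> N"
    proof (rule NI)
      show "\<forall>\<^sub>\<infinity>x. x \<in> \<Omega> \<longrightarrow> (\<exists>P\<in>polys. \<forall>\<^sub>\<infinity>l. l \<in> \<Lambda> x \<longrightarrow> ((\<lambda>x l. scale l 1 - a) * m) x l = P l)"
        using ND[OF \<open>m \<in> N\<close>]
      proof eventually_elim
        case (elim x)
        show ?case
        proof
          assume "x \<in> \<Omega>"
          then obtain P where P: "P \<in> polys" "\<forall>\<^sub>\<infinity>l. l \<in> \<Lambda> x \<longrightarrow> m x l = P l"
            using elim by blast
          have "\<forall>\<^sub>\<infinity>l. l \<in> \<Lambda> x \<longrightarrow> ((\<lambda>x l. scale l 1 - a) * m) x l = (((\<lambda>l. scale l 1) - (\<lambda>_. a)) * P) l"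
            using P(2) by eventually_elim simp
          moreover have "((\<lambda>l. scale l 1) - (\<lambda>_. a)) * P \<in> polys"
            using P(1) by (intro polys_mult polys_diff polys_scalar polys_const)
          ultimately show "\<exists>P\<in>polys. \<forall>\<^sub>\<infinity>l. l \<in> \<Lambda> x \<longrightarrow> ((\<lambda>x l. scale l 1 - a) * m) x l = P l"
            by (intro bexI[of _ "((\<lambda>l. scale l 1) - (\<lambda>_. a)) * P"])
        qed
      qed
    qed
  next
    fix d q assume "d \<in> Z"
    then obtain f where f: "d = (\<lambda>x l. f x)" "\<forall>\<^sub>\<infinity>x. f x = 0"
      using ZE by metis
    show "d * q \<in> N"
    proof (rule NI)
      show "\<forall>\<^sub>\<infinity>x. x \<in> \<Omega> \<longrightarrow> (\<exists>P\<in>polys. \<forall>\<^sub>\<infinity>l. l \<in> \<Lambda> x \<longrightarrow> (d * q) x l = P l)"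
        using f(2) by eventually_elim (auto simp: f(1) intro!: bexI[of _ 0])
    qed
  next
    show "(\<lambda>x l. scale l 1 - a) * (\<lambda>x l. y l) = (1 :: 'k \<Rightarrow> 'k \<Rightarrow> 'd)"
      using a_not_scalar by (simp add: fun_eq_iff y_def)
  next
    show "(\<lambda>x l. y l) \<notin> N"
    proof
      assume "(\<lambda>x l. y l) \<in> N"
      define good where "good x \<longleftrightarrow> (\<exists>P\<in>polys. \<forall>\<^sub>\<infinity>l. l \<in> \<Lambda> x \<longrightarrow> y l = P l)" for x
      from ND[OF \<open>(\<lambda>x l. y l) \<in> N\<close>] have "finite {x. \<not> (x \<in> \<Omega> \<longrightarrow> good x)}"
        unfolding good_def eventually_cofinite .
      then have "infinite (\<Omega> - {x. \<not> (x \<in> \<Omega> \<longrightarrow> good x)})"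
        using inf by (rule Diff_infinite_finite)
      then obtain x where x: "x \<in> \<Omega>" "good x"
        using infinite_imp_nonempty by blast
      then obtain P where P: "P \<in> polys" "\<forall>\<^sub>\<infinity>l. l \<in> \<Lambda> x \<longrightarrow> y l = P l"
        unfolding good_def by (elim bexE)
      have "((\<lambda>l. scale l 1) - (\<lambda>_. a)) * P - 1 = 0"
      proof (rule poly_eq_0_if_infinite_zeros)
        show "((\<lambda>l. scale l 1) - (\<lambda>_. a)) * P - 1 \<in> polys"
          using P(1) by (intro polys_mult polys_diff polys_scalar polys_const polys_one)
        have "\<Lambda> x - {l. \<not> (l \<in> \<Lambda> x \<longrightarrow> y l = P l)} \<subseteq> {l. (((\<lambda>l. scale l 1) - (\<lambda>_. a)) * P - 1) l = 0}"
        proof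
          fix l assume l: "l \<in> \<Lambda> x - {l. \<not> (l \<in> \<Lambda> x \<longrightarrow> y l = P l)}"
          then have "P l = inverse (scale l 1 - a)"
            by (auto simp: y_def)
          then show "l \<in> {l. (((\<lambda>l. scale l 1) - (\<lambda>_. a)) * P - 1) l = 0}"
            using a_not_scalar[of l] by simp
        qed
        moreover have "infinite (\<Lambda> x - {l. \<not> (l \<in> \<Lambda> x \<longrightarrow> y l = P l)})"
          using x P(2) unfolding \<Omega>_def eventually_cofinite by (intro Diff_infinite_finite) auto
        ultimately show "infinite {l. (((\<lambda>l. scale l 1) - (\<lambda>_. a)) * P - 1) l = 0}"
          by (rule infinite_super)
      qed
      then have "(scale l 1 - a) * P l = 1" for l
        by (simp add: fun_eq_iff)
      from linear_mult_eq_const[OF P(1) this] show False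
        by simp
    qed
  next
    fix d assume "d \<in> K"
    then obtain f where f: "d = (\<lambda>x l. f x)"
      using KE by metis
    show "(\<lambda>x l. scale l 1 - a) * d - d * (\<lambda>x l. scale l 1 - a) = d * (\<lambda>x l. a) - (\<lambda>x l. a) * d"
      by (simp add: f fun_eq_iff left_diff_distrib right_diff_distrib scalar_commute)
  next
    show "(\<lambda>x l. a) \<in> K"
      using KI[OF rational_const[of a]] .
    show "(\<lambda>x l. \<beta> i x) \<in> K" for i
      using KI[OF \<beta>] .
  next
    fix u and e :: "bool \<Rightarrow> 'k \<Rightarrow> 'k \<Rightarrow> 'd" and i
    assume u: "u \<in> K" and e: "\<And>i. e i \<in> K" "\<And>i. (\<lambda>x l. a) * e i - e i * (\<lambda>x l. a) \<in> Z"
      and eq: "(\<lambda>x l. a) * u - u * (\<lambda>x l. a) - (\<Sum>i\<in>UNIV. e i * (\<lambda>x l. \<beta> i x)) \<in> Z"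
    obtain U where U: "u = (\<lambda>x l. U x)" "rational U"
      using KE[OF u] by blast
    obtain f where f: "\<And>i. e i = (\<lambda>x l. f i x)" "\<And>i. rational (f i)"
      using KE[OF e(1)] by metis
    have "(\<lambda>x l. (\<lambda>x. a * f i x - f i x * a) x) \<in> Z" for i
      using e(2)[of i] by (simp add: f(1) fun_diff_def times_fun_def)
    then have commutator: "\<forall>\<^sub>\<infinity>x. a * f i x - f i x * a = 0" for i
      by (simp only: Z_iff)
    have comm: "\<forall>\<^sub>\<infinity>x. f i x * a = a * f i x" for i
      using commutator[of i] by eventually_elim simp
    have "(\<lambda>x l. (\<lambda>x. a * U x - U x * a - (f True x * z x + f False x * (b * z x))) x) \<in> Z"
      using eq by (simp add: f(1) U(1) fun_diff_def times_fun_def UNIV_bool \<beta>_def plus_fun_def add.commute)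
    then have "\<forall>\<^sub>\<infinity>x. a * U x - U x * a - (f True x * z x + f False x * (b * z x)) = 0"
      by (simp only: Z_iff)
    then have "\<forall>\<^sub>\<infinity>x. a * U x - U x * a = f True x * z x + f False x * (b * z x)"
      by (auto elim: eventually_mono)
    then have "(\<forall>\<^sub>\<infinity>x. f True x = 0) \<and> (\<forall>\<^sub>\<infinity>x. f False x = 0)"
      using resolvent_terms_vanish_if_commutator[OF nl nr U(2) f(2) f(2) comm comm] unfolding z_def by blast
    then have "\<forall>\<^sub>\<infinity>x. f i x = 0"
      by (cases i) auto
    then show "e i \<in> Z"
      unfolding f(1) using f(2) by (intro ZI)
  next
    show "d I \<in> K" for I
      unfolding d_def by (rule KI[OF rational_const])
  next
    show "(\<Sum>I | length I \<le> n. d I * iterated_word (\<lambda>x l. y l) (\<lambda>i x l. \<beta> i x) I) \<in> N"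
    proof (rule NI, rule always_eventually, intro allI impI bexI always_eventually)
      fix x l assume "l \<in> \<Lambda> x"
      have word: "W I x l = y l * word_value (\<lambda>i. \<beta> i x * y l) (Monomial I)" for I
        unfolding W_def by (induction I) (simp_all add: word_value_def mult.assoc)
      have sum_apply: "(\<Sum>I\<in>A. F I) x l = (\<Sum>I\<in>A. F I x l)" for A :: "bool list set" and F :: "bool list \<Rightarrow> 'k \<Rightarrow> 'k \<Rightarrow> 'd"
        by (induction A rule: infinite_finite_induct) simp_all
      have "(\<Sum>I | length I \<le> n. d I * W I) x l =
          (\<Sum>I | length I \<le> n. scale (Poly_Mapping.lookup g (Monomial I)) (y l * word_value (\<lambda>i. \<beta> i x * y l) (Monomial I)))"
        by (simp add: sum_apply d_def word scale_mult_left)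
      also have "\<dots> = y l * (\<Sum>I | length I \<le> n. scale (Poly_Mapping.lookup g (Monomial I)) (word_value (\<lambda>i. \<beta> i x * y l) (Monomial I)))"
        by (simp add: sum_distrib_left scale_mult_right)
      also have "(\<Sum>I | length I \<le> n. scale (Poly_Mapping.lookup g (Monomial I)) (word_value (\<lambda>i. \<beta> i x * y l) (Monomial I))) =
          (\<Sum>w\<in>Monomial ` {I. length I \<le> n}. scale (Poly_Mapping.lookup g w) (word_value (\<lambda>i. \<beta> i x * y l) w))"
        by (subst sum.reindex) (auto simp: inj_on_def)
      also have "\<dots> = free_eval (\<lambda>i. \<beta> i x * y l) g"
      proof (rule free_eval_superset[symmetric])
        show "finite (Monomial ` {I :: bool list. length I \<le> n})"
          using finite_lists_length_le[of "UNIV :: bool set" n] by simp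
        show "Poly_Mapping.keys g \<subseteq> Monomial ` {I. length I \<le> n}"
        proof
          fix w assume "w \<in> Poly_Mapping.keys g"
          then show "w \<in> Monomial ` {I. length I \<le> n}"
            using n by (intro image_eqI[of _ _ "letters w"]) simp_all
        qed
      qed
      also have "\<dots> = 0"
        using \<open>l \<in> \<Lambda> x\<close> by (simp add: \<Lambda>_def)
      finally show "(\<Sum>I | length I \<le> n. d I * iterated_word (\<lambda>x l. y l) (\<lambda>i x l. \<beta> i x) I) x l = 0 l"
        by (simp only: W_def zero_fun_def mult_zero_right)
    qed auto
  qed (rule that)
  have "Poly_Mapping.lookup g w = 0" for w
  proof (cases "w \<in> Poly_Mapping.keys g")
    case True
    from vanish[OF n[OF True]] have "(\<lambda>x l. (\<lambda>_. scale (Poly_Mapping.lookup g w) 1) x) \<in> Z"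
      by (simp add: d_def)
    then have "\<forall>\<^sub>\<infinity>x :: 'k. scale (Poly_Mapping.lookup g w) (1 :: 'd) = 0"
      by (simp only: Z_iff)
    then show ?thesis
      using infinite_field by (auto simp: eventually_cofinite)
  qed (simp add: in_keys_iff)
  then have "g = 0"
    by (intro poly_mapping_eqI) simp
  then show False
    using \<open>g \<noteq> 0\<close> by simp
qed

text \<open>
  First \<open>x\<close> is chosen outside a countable union of finite sets, and then, for this \<open>x\<close>, \<open>l\<close> outside
  another one.
\<close>

lemma contains_free_algebra_if_neither_algebraic:
  fixes a b :: 'd
  assumes "uncountable (UNIV :: 'k set)"
    and "\<not> left_algebraic_elt (centralizer a) b" "\<not> right_algebraic_elt (centralizer a) b"
  shows "contains_free_algebra_2 scale"
proof -
  define z where "z x = inverse (scale x 1 - b ^ 2)" for x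
  define y where "y l = inverse (scale l 1 - a)" for l
  define v where "v x l = (\<lambda>i. if i then z x * y l else b * z x * y l)" for x l
  let ?G = "integral_elements - {0} :: (bool free_monoid \<Rightarrow>\<^sub>0 'k) set"
  have G: "countable ?G"
    using countable_integral_elements by (rule countable_Diff)
  have bad: "finite {x. infinite {l. free_eval (v x l) g = 0}}" if "g \<in> ?G" for g
    using finite_bad_parameters[OF assms(2,3), of g] that unfolding v_def z_def y_def by simp
  have "countable (\<Union>g\<in>?G. {x. infinite {l. free_eval (v x l) g = 0}})"
    using G bad by (intro countable_UN) (auto intro: countable_finite)
  then obtain x where x: "x \<notin> (\<Union>g\<in>?G. {x. infinite {l. free_eval (v x l) g = 0}})"
    using assms(1) by (metis UNIV_eq_I)
  then have "countable (\<Union>g\<in>?G. {l. free_eval (v x l) g = 0})"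
    using G by (intro countable_UN) (auto intro: countable_finite)
  then obtain l where l: "l \<notin> (\<Union>g\<in>?G. {l. free_eval (v x l) g = 0})"
    using assms(1) by (metis UNIV_eq_I)
  have "inj (free_eval (v x l))"
    by (rule inj_free_eval_if_integral_kernel_trivial) (use l in blast)
  then have "free_on scale (v x l)"
    by (rule free_on_if_inj_free_eval)
  then show ?thesis
    unfolding contains_free_algebra_2_def v_def by blast
qed

end

theorem theorem1p1:
  fixes scale :: "'k::field \<Rightarrow> 'd::division_ring \<Rightarrow> 'd"
    and a :: 'd
  assumes "k_algebra scale"
    and "uncountable (UNIV :: 'k set)"
    and "a \<noteq> 0"
    and "CHAR('k) > 0 \<Longrightarrow> \<not> (\<exists>u. a * u * inverse a = u + 1)"
    and "\<not> left_algebraic_over (centralizer a)"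
    and "\<not> right_algebraic_over (centralizer a)"
  shows "contains_free_algebra_2 scale"
proof -
  interpret k_algebra scale
    by fact
  interpret infinite_division_algebra scale
    using assms(2) by unfold_locales (auto intro: countable_finite)
  obtain b b' where "\<not> left_algebraic_elt (centralizer a) b" "\<not> right_algebraic_elt (centralizer a) b'"
    using assms(5,6) by (auto simp: left_algebraic_over_def right_algebraic_over_def)
  then obtain c where "\<not> left_algebraic_elt (centralizer a) c" "\<not> right_algebraic_elt (centralizer a) c"
    using exists_neither_left_nor_right_algebraic[OF assms(2)] by blast
  then show ?thesis
    by (rule contains_free_algebra_if_neither_algebraic[OF assms(2)])
qed

end
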